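(* Let $\kappa=\rho\, e^{2\pi i p/q}\in\mathbb{C}\setminus\mathbb{R}$ with $0<\rho<1$ and $p,q$ coprime integers, $q\ge1$. Put $q'=q$ if $q$ is odd and $q'=q/2$ if $q$ is even, and let $\beta=\rho^{-q'}>1$. Then the set of uniqueness $\mathcal{U}_\kappa$ is: (1) finite and non-empty if $\beta\in(1,G]$; (2) infinite countable if $\beta\in(G,\beta_* )$; (3) an uncountable set of zero Hausdorff dimension if $\beta=\beta_*$; (4) a set of positive Hausdorff dimension if $\beta\in(\beta_*,\infty)$.
   Context: For $\kappa\in\mathbb{C}$, $|\kappa|<1$, $A_\kappa\subset\mathbb{C}$ is the attractor of the maps $T_m(z)=\kappa z-1$, $T_p(z)=\kappa z+1$, i.e. the unique non-empty compact set with $A_\kappa=T_m(A_\kappa)\cup T_p(A_\kappa)$. Identifying $m$ with $-1$ and $p$ with $+1$, $\pi(a_0a_1a_2\dots)=\sum_{j=0}^\infty a_j\kappa^j$ for $(a_j)\in\{-1,+1\}^{\mathbb{N}}$; such a sequence is an address of the point $\pi(a_0a_1\dots)\in A_\kappa$. The set of uniqueness $\mathcal{U}_\kappa$ is the set of points of $A_\kappa$ having exactly one address. $G=\frac{1+\sqrt5}{2}$. $\beta_*=1.787231650\dots$ is the Komornik–Loreti constant: the unique solution $x>1$ of $\sum_{n=1}^\infty \mathfrak{m}_n x^{-n+1}=1$, where $(\mathfrak{m}_n)_{n\ge1}=0110\,1001\,1001\,0110\dots$ is the Thue–Morse sequence, i.e. the fixed point starting with $0$ of the substitution $0\to01$,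 $1\to10$. *)

theory Defs
  imports "HOL-Analysis.Analysis"
begin

definition attractor :: "complex \<Rightarrow> complex set" where
  "attractor \<kappa> =
     (THE A. compact A \<and> A \<noteq> {} \<and> A = (\<lambda>z. \<kappa> * z - 1) ` A \<union> (\<lambda>z. \<kappa> * z + 1) ` A)"

text \<open>The symbols \<open>m\<close> and \<open>p\<close> are identified with \<open>-1\<close> and \<open>+1\<close>, so a symbolic sequence is a
  function \<open>nat \<Rightarrow> int\<close> with values in \<open>{-1, 1}\<close>. The series converges for \<open>norm \<kappa> < 1\<close>.\<close>

definition address_point :: "complex \<Rightarrow> (nat \<Rightarrow> int) \<Rightarrow> complex" where
  "address_point \<kappa> a = (\<Sum>j. of_int (a j) * \<kappa> ^ j)"

definition is_address :: "complex \<Rightarrow> (nat \<Rightarrow> int) \<Rightarrow> complex \<Rightarrow> bool" where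
  "is_address \<kappa> a z \<longleftrightarrow> range a \<subseteq> {-1, 1} \<and> address_point \<kappa> a = z"

definition uniqueness_set :: "complex \<Rightarrow> complex set" where
  "uniqueness_set \<kappa> = {z \<in> attractor \<kappa>. \<exists>!a. is_address \<kappa> a z}"

definition golden_ratio :: real where
  "golden_ratio = (1 + sqrt 5) / 2"

definition tm_substitution :: "nat \<Rightarrow> nat list" where
  "tm_substitution a = (if a = 0 then [0, 1] else [1, 0])"

text \<open>The fixed point of the substitution that starts with 0, indexed from 0: the letter
  at position \<open>n\<close> is replaced by the letters at positions \<open>2n\<close> and \<open>2n + 1\<close>.\<close>

definition thue_morse :: "nat \<Rightarrow> nat" where
  "thue_morse =
     (THE t. range t \<subseteq> {0, 1} \<and> t 0 = 0 \<and>
        (\<forall>n. [t (2 * n), t (2 * n + 1)] = tm_substitution (t n)))"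

text \<open>With the Thue-Morse sequence indexed from 1 the defining equation is
  \<open>(\<Sum>n\<ge>1. m n * x powi (1 - n)) = 1\<close>; here the index is shifted by one.\<close>

definition komornik_loreti :: real where
  "komornik_loreti =
     (THE x. x > 1 \<and> (\<lambda>n. real (thue_morse n) * x powi (- int n)) sums 1)"

text \<open>Boundedness is required of the covering sets because \<open>diameter\<close> is only
  meaningful for bounded sets. The empty set has diameter 0, so finite covers are included.\<close>

definition hausdorff_premeasure ::
    "real \<Rightarrow> real \<Rightarrow> 'a::metric_space set \<Rightarrow> ennreal" where
  "hausdorff_premeasure s \<delta> E =
     (INF U \<in> {U :: nat \<Rightarrow> 'a set. E \<subseteq> (\<Union>i. U i) \<and>
                  (\<forall>i. bounded (U i) \<and> diameter (U i) \<le> \<delta>)}.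
        (\<Sum>i. ennreal (diameter (U i) powr s)))"

definition hausdorff_measure :: "real \<Rightarrow> 'a::metric_space set \<Rightarrow> ennreal" where
  "hausdorff_measure s E = (SUP \<delta> \<in> {0<..}. hausdorff_premeasure s \<delta> E)"

text \<open>Only \<open>s > 0\<close> is used, which does not change the infimum and avoids the
  convention \<open>0 powr 0 = 0\<close>.\<close>

definition hausdorff_dim :: "'a::metric_space set \<Rightarrow> ereal" where
  "hausdorff_dim E = (INF s \<in> {s. 0 < s \<and> hausdorff_measure s E = 0}. ereal s)"

end

theory Submission
  imports Defs
begin

text \<open>Write \<open>l = 1 / \<beta>\<close>. The power \<open>\<kappa> ^ q'\<close> is \<open>\<plusminus> l\<close>, so splitting an address by residues modulo \<open>q'\<close>
writes a point as \<open>\<Sum>r<q'. \<kappa> ^ r * x r\<close> with real \<open>x r\<close> expanded in base \<open>\<plusminus> \<beta>\<close>; an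
alternating sign change of the digits reduces this to base \<open>\<beta>\<close>, and digits \<open>\<plusminus> 1\<close> are
traded for Boolean ones. Two observations reduce the theorem to the classical real
problem of univoque sequences, those whose value in base \<open>\<beta>\<close> is attained only once.

From above: if \<open>\<beta> \<le> 2\<close>, a residue subsequence that is not univoque can be exchanged for
another one with the same value, so all residue subsequences of a unique address are
univoque. From below: choose every digit outside residue 0 so that it maximizes the
imaginary part of the point. These digits are then forced, because \<open>\<kappa> ^ j\<close> is not real for
such \<open>j\<close>, and what is left is real. Hence any univoque sequence may be put into residue 0,
and up to scaling this embeds the real set of uniqueness isometrically into the complex one.

For the real problem, let \<open>after d n\<close> be the tail of \<open>d\<close> behind position \<open>n\<close>, complemented if
\<open>d n\<close> holds. Then \<open>d\<close> is univoque if all \<open>after d n\<close> have value below 1, and the converse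
holds for \<open>\<beta> \<le> 2\<close>. Let \<open>tau\<close> be the Thue--Morse sequence without its first letter; its value
is 1 exactly in base \<open>komornik_loreti\<close>, and it is larger than 1 in smaller bases.

\<^item> If \<open>\<beta>\<close> is at most the golden ratio, a switch between two letters is impossible, so only
the constant sequences are univoque. Above it, \<open>0 \<dots> 0 1 0 1 0 \<dots>\<close> is univoque.

\<^item> If \<open>\<beta>\<close> is at most the Komornik--Loreti constant, all \<open>after d n\<close> are lexicographically
below \<open>tau\<close>. A sequence with this property is constant or has a tail in the image of the
Thue--Morse substitution, and its preimage has the property again (\<open>desubstitution\<close>). In the
subcritical case the comparison is decided within boundedly many letters, so that after
finitely many steps only constants remain: univoque sequences are eventually periodic,
hence countable. In the critical case the step can be repeated forever, so for every \<open>k\<close> a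
tail is made of two blocks of length \<open>2 ^ k\<close>. This leaves at most one bit of choice in \<open>2 ^ k\<close>
letters, so the dimension is 0. Conversely, the sequences obtained by optionally prepending
a letter before each substitution are uncountably many.

\<^item> Above the Komornik--Loreti constant, \<open>tau\<close> has value below 1 by a definite amount, so it
is enough to compare with \<open>tau\<close> on a long prefix. Therefore the \<open>k\<close>-fold substitution of every
sequence is univoque for large \<open>k\<close>, and reading off the original sequence in base 2 is a
Hoelder map onto the unit interval, which forces positive dimension.\<close>



section \<open>The Thue--Morse substitution and the lexicographic order\<close>

function tm :: "nat \<Rightarrow> bool" where
  "tm n = (if n = 0 then False else tm (n div 2) \<noteq> odd n)"
  by auto
termination by (relation "Wellfounded.measure id") auto
declare tm.simps [simp del]

text \<open>The Thue--Morse sequence without its first letter. The value of this sequence in base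
\<open>\<beta>\<close> is the series that defines the Komornik--Loreti constant.\<close>

definition tau :: "nat \<Rightarrow> bool" where "tau j = tm (Suc j)"

text \<open>The substitution \<open>0 \<mapsto> 01\<close>, \<open>1 \<mapsto> 10\<close> on infinite sequences.\<close>

definition theta :: "(nat \<Rightarrow> bool) \<Rightarrow> nat \<Rightarrow> bool" where
  "theta e m = (e (m div 2) \<noteq> odd m)"

text \<open>Complementing the tail when \<open>d n\<close> holds turns the two mirror-image conditions on
univoque sequences (behind a 0 and behind a 1) into a single one.\<close>

definition after :: "(nat \<Rightarrow> bool) \<Rightarrow> nat \<Rightarrow> nat \<Rightarrow> bool" where
  "after d n j = (d (Suc (n + j)) \<noteq> d n)"

definition tail :: "nat \<Rightarrow> (nat \<Rightarrow> bool) \<Rightarrow> nat \<Rightarrow> bool" where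
  "tail m d j = d (m + j)"

definition lex_less_at :: "nat \<Rightarrow> (nat \<Rightarrow> bool) \<Rightarrow> (nat \<Rightarrow> bool) \<Rightarrow> bool" where
  "lex_less_at k x y \<longleftrightarrow> (\<forall>j<k. x j = y j) \<and> \<not> x k \<and> y k"

lemma tm_0: "\<not> tm 0"
  by (subst tm.simps) simp

lemma tm_theta: "theta tm = tm"
proof
  fix n show "theta tm n = tm n"
    using tm.simps[of n] by (auto simp: theta_def tm_0)
qed

lemma tm_double: "tm (2 * n) = tm n" "tm (Suc (2 * n)) = (\<not> tm n)"
  using fun_cong[OF tm_theta, of "2*n"] fun_cong[OF tm_theta, of "Suc (2*n)"]
  by (auto simp: theta_def)

text \<open>The letter at \<open>n\<close> is determined by the letter at \<open>n div 2\<close>, so the substitution has exactly one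
fixed point that starts with 0, and the recursion on binary digits computes it.\<close>

lemma thue_morse_eq: "thue_morse n = of_bool (tm n)"
proof -
  have ex: "range (\<lambda>n. of_bool (tm n) :: nat) \<subseteq> {0, 1} \<and> of_bool (tm 0) = (0::nat) \<and>
        (\<forall>n. [of_bool (tm (2 * n)), of_bool (tm (2 * n + 1))] = tm_substitution (of_bool (tm n)))"
  proof (intro conjI allI)
    fix n
    show "[of_bool (tm (2 * n)), of_bool (tm (2 * n + 1))] = tm_substitution (of_bool (tm n))"
      by (auto simp: tm_substitution_def tm_double)
  qed (auto simp: tm_0)
  have "thue_morse = (\<lambda>n. of_bool (tm n))"
    unfolding thue_morse_def
  proof (rule the_equality)
    fix t :: "nat \<Rightarrow> nat"
    assume t: "range t \<subseteq> {0, 1} \<and> t 0 = 0 \<and>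
        (\<forall>n. [t (2 * n), t (2 * n + 1)] = tm_substitution (t n))"
    show "t = (\<lambda>n. of_bool (tm n))"
    proof
      fix n show "t n = of_bool (tm n)"
      proof (induction n rule: less_induct)
        case (less n)
        show ?case
        proof (cases "n = 0")
          case True then show ?thesis using t by (simp add: tm_0)
        next
          case False
          define k where "k = n div 2"
          have IH: "t k = of_bool (tm k)" using less[of k] False by (auto simp: k_def)
          have "[t (2 * k), t (2 * k + 1)] = tm_substitution (t k)" using t by blast
          moreover have "n = 2 * k \<or> n = 2 * k + 1" by (auto simp: k_def)
          ultimately show ?thesis using IH False
            by (auto simp: tm_substitution_def tm_double split: if_splits)
        qed
      qed
    qed
  qed (use ex in auto)
  then show ?thesis by (rule fun_cong)
qed

text \<open>Since the Thue--Morse sequence is the fixed point of \<open>theta\<close>, removing its first letter gives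
the self-similarity \<open>tau = 1 theta(tau)\<close> that drives all comparisons with \<open>tau\<close>.\<close>

lemma tau_0: "tau 0" and tau_Suc: "tau (Suc m) = theta tau m"
proof -
  show "tau 0" using tm_double(2)[of 0] by (simp add: tau_def tm_0)
  show "tau (Suc m) = theta tau m"
    using fun_cong[OF tm_theta, of "m + 2"] by (auto simp: tau_def theta_def)
qed

lemma tau_prefix: "tau 0" "tau (Suc 0)" "\<not> tau 2" "tau 3" "\<not> tau 4" "\<not> tau 5"
  using tau_0 tau_Suc[of 0] tau_Suc[of 1] tau_Suc[of 2] tau_Suc[of 3] tau_Suc[of 4]
  by (simp_all add: theta_def numeral_2_eq_2[symmetric] numeral_3_eq_3[symmetric])

text \<open>Behind the first letter of a block, \<open>after\<close> reproduces the self-similarity of \<open>tau\<close>; behind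
the second letter it can never start with \<open>11\<close>, so there the comparison with \<open>tau\<close> is trivial.\<close>

lemma after_theta_even:
  "after (theta e) (2 * i) 0" "after (theta e) (2 * i) (Suc m) = theta (after e i) m"
  by (auto simp: after_def theta_def)

lemma after_theta_odd:
  "\<not> (after (theta e) (Suc (2 * i)) 0 \<and> after (theta e) (Suc (2 * i)) (Suc 0))"
  by (auto simp: after_def theta_def)

lemma after_tail: "after (tail m d) n = after d (m + n)"
  by (auto simp: after_def tail_def fun_eq_iff add.assoc)

lemma lex_less_at_asym: "lex_less_at k x y \<Longrightarrow> \<not> lex_less_at k' y x"
  by (cases k k' rule: linorder_cases) (auto simp: lex_less_at_def)

lemma lex_trichotomy: "x = y \<or> (\<exists>k. lex_less_at k x y) \<or> (\<exists>k. lex_less_at k y x)"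
proof (cases "x = y")
  case False
  then have "\<exists>k. x k \<noteq> y k" by auto
  then obtain k where "x k \<noteq> y k" "\<And>j. j < k \<Longrightarrow> x j = y j"
    using exists_least_iff[of "\<lambda>k. x k \<noteq> y k"] by auto
  then show ?thesis unfolding lex_less_at_def by metis
qed auto

text \<open>Two images under the substitution first differ at the first letter of a block.\<close>

lemma lex_less_at_theta:
  "lex_less_at m (theta x) (theta y) \<longleftrightarrow> (\<exists>k. m = 2 * k \<and> lex_less_at k x y)"
proof
  assume L: "lex_less_at m (theta x) (theta y)"
  have even: "even m"
  proof (rule ccontr)
    assume "odd m"
    then obtain k where "m = Suc (2 * k)" by (auto elim: oddE)
    then have "theta x (2 * k) = theta y (2 * k)" "theta x (Suc (2*k)) \<noteq> theta y (Suc (2*k))"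
      using L by (auto simp: lex_less_at_def)
    then show False by (auto simp: theta_def)
  qed
  then obtain k where k: "m = 2 * k" by (auto elim: evenE)
  have "x j = y j" if "j < k" for j
  proof -
    have "theta x (2 * j) = theta y (2 * j)"
      using L that by (auto simp: lex_less_at_def k)
    then show ?thesis by (simp add: theta_def)
  qed
  moreover have "\<not> x k" "y k" using L by (auto simp: lex_less_at_def k theta_def)
  ultimately show "\<exists>k. m = 2 * k \<and> lex_less_at k x y" using k by (auto simp: lex_less_at_def)
next
  assume "\<exists>k. m = 2 * k \<and> lex_less_at k x y"
  then obtain k where "m = 2 * k" "lex_less_at k x y" by auto
  then show "lex_less_at m (theta x) (theta y)"
    by (auto simp: lex_less_at_def theta_def)
qed

lemma lex_less_at_Suc:
  "x 0 = y 0 \<Longrightarrow> lex_less_at k x y \<longleftrightarrow> 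
   (\<exists>m. k = Suc m \<and> lex_less_at m (\<lambda>j. x (Suc j)) (\<lambda>j. y (Suc j)))"
  by (cases k) (auto simp: lex_less_at_def less_Suc_eq_0_disj)

lemma lex_after_theta:
  "lex_less_at k (after (theta e) (2 * i)) tau \<longleftrightarrow> (\<exists>j. k = 2 * j + 1 \<and> lex_less_at j (after e i) tau)"
  "lex_less_at k tau (after (theta e) (2 * i)) \<longleftrightarrow> (\<exists>j. k = 2 * j + 1 \<and> lex_less_at j tau (after e i))"
proof -
  have eq: "after (theta e) (2 * i) 0 = tau 0" by (simp add: after_theta_even tau_0)
  have fs: "(\<lambda>j. after (theta e) (2 * i) (Suc j)) = theta (after e i)" "(\<lambda>j. tau (Suc j)) = theta tau"
    by (auto simp: after_theta_even tau_Suc)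
  show "lex_less_at k (after (theta e) (2 * i)) tau \<longleftrightarrow> (\<exists>j. k = 2 * j + 1 \<and> lex_less_at j (after e i) tau)"
    unfolding lex_less_at_Suc[of "after (theta e) (2 * i)" tau, OF eq] fs lex_less_at_theta by auto
  show "lex_less_at k tau (after (theta e) (2 * i)) \<longleftrightarrow> (\<exists>j. k = 2 * j + 1 \<and> lex_less_at j tau (after e i))"
    unfolding lex_less_at_Suc[of tau "after (theta e) (2 * i)", OF eq[symmetric]] fs lex_less_at_theta by auto
qed

text \<open>The two notions differ in how far a comparison with \<open>tau\<close> is observed.
\<open>tm_bounded K\<close> says that no \<open>after d n\<close> is seen to exceed \<open>tau\<close> on the first \<open>K\<close> letters, which is
a condition on finite windows and so is inherited by limits; \<open>tm_strictly_bounded K\<close> says that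
each of them is already seen to be smaller there.\<close>
definition tm_bounded :: "nat \<Rightarrow> (nat \<Rightarrow> bool) \<Rightarrow> bool" where
  "tm_bounded K d \<longleftrightarrow> (\<forall>n. \<forall>k<K. \<not> lex_less_at k tau (after d n))"

definition tm_strictly_bounded :: "nat \<Rightarrow> (nat \<Rightarrow> bool) \<Rightarrow> bool" where
  "tm_strictly_bounded K d \<longleftrightarrow> (\<forall>n. \<exists>k<K. lex_less_at k (after d n) tau)"

lemma tm_bounded_one: "tm_bounded 1 d"
  by (auto simp: tm_bounded_def lex_less_at_def tau_0)

lemma tm_bounded_theta:
  assumes "tm_bounded K e" shows "tm_bounded (2 * K + 1) (theta e)"
  unfolding tm_bounded_def
proof (intro allI impI notI)
  fix n k assume k: "k < 2 * K + 1" and L: "lex_less_at k tau (after (theta e) n)"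
  show False
  proof (cases "even n")
    case True
    then obtain i where "n = 2 * i" by (auto elim: evenE)
    then show False using L k assms by (auto simp: lex_after_theta tm_bounded_def)
  next
    case False
    then obtain i where i: "n = Suc (2 * i)" by (auto elim: oddE)
    have "\<not> tau k" using L by (auto simp: lex_less_at_def)
    then have "k \<noteq> 0" "k \<noteq> Suc 0" using tau_prefix by metis+
    then have "after (theta e) n 0 = tau 0" "after (theta e) n (Suc 0) = tau (Suc 0)"
      using L by (auto simp: lex_less_at_def)
    then show False using after_theta_odd[of e i] by (auto simp: tau_prefix i)
  qed
qed

lemma tm_bounded_mono: "tm_bounded K d \<Longrightarrow> K' \<le> K \<Longrightarrow> tm_bounded K' d"
  by (auto simp: tm_bounded_def)

text \<open>Every sequence is bounded to depth 1 because \<open>tau\<close> starts with 1, and each substitution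
doubles the depth, so arbitrary sequences reach any
depth after enough substitutions.\<close>

lemma tm_bounded_theta_iter: "tm_bounded (2 ^ k) ((theta ^^ k) e)"
proof (induction k)
  case 0 show ?case using tm_bounded_one by simp
next
  case (Suc k)
  show ?case using tm_bounded_mono[OF tm_bounded_theta[OF Suc.IH], of "2 ^ Suc k"] by simp
qed

lemma tm_bounded_tail: "tm_bounded K d \<Longrightarrow> tm_bounded K (tail m d)"
  by (auto simp: tm_bounded_def after_tail)

lemma tm_strictly_bounded_tail: "tm_strictly_bounded K d \<Longrightarrow> tm_strictly_bounded K (tail m d)"
  by (auto simp: tm_strictly_bounded_def after_tail)

lemma tm_strictly_bounded_imp: "tm_strictly_bounded K d \<Longrightarrow> tm_bounded K' d"
  unfolding tm_bounded_def tm_strictly_bounded_def using lex_less_at_asym by blast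

lemma tm_bounded_theta_D:
  assumes "\<And>K. tm_bounded K (theta e)" shows "tm_bounded K e"
  unfolding tm_bounded_def
proof (intro allI impI notI)
  fix n k assume "lex_less_at k tau (after e n)"
  then have "lex_less_at (2 * k + 1) tau (after (theta e) (2 * n))" by (auto simp: lex_after_theta)
  then show False using assms[of "2 * k + 2"] by (auto simp: tm_bounded_def)
qed

lemma tm_strictly_bounded_theta_D:
  assumes "tm_strictly_bounded (2 * K) (theta e)" shows "tm_strictly_bounded K e"
  unfolding tm_strictly_bounded_def
proof
  fix n
  obtain k where "k < 2 * K" "lex_less_at k (after (theta e) (2 * n)) tau"
    using assms unfolding tm_strictly_bounded_def by blast
  then obtain j where "k = 2 * j + 1" "lex_less_at j (after e n) tau" "2 * j + 1 < 2 * K"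
    unfolding lex_after_theta by blast
  then show "\<exists>k<K. lex_less_at k (after e n) tau" by (intro exI[of _ j]) auto
qed

lemma constant_if_no_switch:
  assumes "\<And>n. d (Suc n) = d n" shows "d = (\<lambda>_. d 0)"
proof
  fix n show "d n = d 0" by (induction n) (auto simp: assms)
qed

lemma theta_iff_switches:
  fixes d :: "nat \<Rightarrow> bool"
  shows "(\<forall>i. d (Suc (2 * i)) \<noteq> d (2 * i)) \<longleftrightarrow> (\<exists>e. d = theta e)"
proof
  assume A: "\<forall>i. d (Suc (2 * i)) \<noteq> d (2 * i)"
  have "d = theta (\<lambda>i. d (2 * i))"
  proof
    fix n
    show "d n = theta (\<lambda>i. d (2 * i)) n"
    proof (cases "even n")
      case True then show ?thesis by (auto simp: theta_def)
    next
      case False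
      then obtain i where "n = Suc (2 * i)" by (auto elim: oddE)
      then show ?thesis using A[rule_format, of i] by (auto simp: theta_def)
    qed
  qed
  then show "\<exists>e. d = theta e" by blast
qed (auto simp: theta_def)

section \<open>Desubstitution of sequences bounded by Thue--Morse\<close>

text \<open>If \<open>d\<close> is not constant and has a double letter behind a switch, the words 111, 11011 and
110101 are excluded behind a 0 (and their complements behind a 1), as they exceed the prefix
110100 of \<open>tau\<close>. Hence, from the middle of the first such double letter on, double letters keep
straddling the boundaries of the blocks of length 2: after a double letter the next one is of the
opposite kind and comes two or four positions later. So every block consists of two different
letters. Without such a double letter the sequence alternates after its first switch.\<close>

lemma desubstitution:
  assumes B: "\<And>K. tm_bounded K d"
  shows "d = (\<lambda>_. d 0) \<or> (\<exists>m e. tail m d = theta e)"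
proof (cases "\<exists>m. d (Suc m) \<noteq> d m \<and> d (m + 2) = d (Suc m)")
  case nodouble: False
  show ?thesis
  proof (cases "\<exists>m. d (Suc m) \<noteq> d m")
    case False
    then show ?thesis using constant_if_no_switch[of d] by blast
  next
    case True
    then obtain m where m: "d (Suc m) \<noteq> d m" by blast
    have "d (Suc (m + i)) \<noteq> d (m + i)" for i
    proof (induction i)
      case (Suc i)
      then show ?case using nodouble by (auto simp: eval_nat_numeral)
    qed (use m in simp)
    then have "\<forall>i. tail m d (Suc (2 * i)) \<noteq> tail m d (2 * i)"
      by (auto simp: tail_def)
    then show ?thesis unfolding theta_iff_switches by blast
  qed
next
  case True
  then obtain m where m: "d (Suc m) \<noteq> d m" "d (m + 2) = d (Suc m)" by blast
  have nv: "\<not> lex_less_at k tau (after d n)" for k n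
    using B[of "Suc k"] by (auto simp: tm_bounded_def)
  (* A double letter that occupies positions \<open>n + 1\<close> and \<open>n + 2\<close> directly behind a switch. *)
  define fresh where "fresh n \<longleftrightarrow> d (n + 1) \<noteq> d n \<and> d (n + 2) = d (n + 1)" for n
  have ad: "after d n 0 = (d (n + 1) \<noteq> d n)" "after d n (Suc 0) = (d (n + 2) \<noteq> d n)"
    "after d n 2 = (d (n + 3) \<noteq> d n)" "after d n 3 = (d (n + 4) \<noteq> d n)"
    "after d n 4 = (d (n + 5) \<noteq> d n)" "after d n 5 = (d (n + 6) \<noteq> d n)" for n
    by (simp_all add: after_def eval_nat_numeral)
  have sm: "(\<forall>j<2. P j) \<longleftrightarrow> P 0 \<and> P (Suc 0)" 
    "(\<forall>j<4. P j) \<longleftrightarrow> P 0 \<and> P (Suc 0) \<and> P 2 \<and> P 3"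
    "(\<forall>j<5. P j) \<longleftrightarrow> P 0 \<and> P (Suc 0) \<and> P 2 \<and> P 3 \<and> P 4" for P :: "nat \<Rightarrow> bool"
    by (auto simp: eval_nat_numeral less_Suc_eq)
  have F1: "d (n + 3) \<noteq> d (n + 1)" if "fresh n" for n
    using nv[of 2 n] that tau_prefix by (auto simp: lex_less_at_def sm ad fresh_def)
  have F2: "d (n + 5) \<noteq> d (n + 4)" if "fresh n" "d (n + 4) = d (n + 1)" for n
    using nv[of 4 n] that F1[OF that(1)] tau_prefix by (auto simp: lex_less_at_def sm ad fresh_def)
  have F3: "d (n + 6) = d n" if "fresh n" "d (n + 4) = d (n + 1)" for n
    using nv[of 5 n] that F1[OF that(1)] F2[OF that] tau_prefix by (auto simp: lex_less_at_def sm ad fresh_def)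
  (* Invariant: the most recent double letter straddles this block boundary or the previous one. *)
  have "fresh (m + 2 * i) \<or> (\<exists>n. m + 2 * i = n + 2 \<and> fresh n \<and> d (n + 4) = d (n + 1))" for i
  proof (induction i)
    case 0 show ?case using m by (simp add: fresh_def)
  next
    case (Suc i)
    then show ?case
    proof
      assume f: "fresh (m + 2 * i)"
      show ?case
      proof (cases "d (m + 2 * i + 4) = d (m + 2 * i + 1)")
        case True then show ?thesis using f by auto
      next
        case False
        then have "fresh (m + 2 * i + 2)" using F1[OF f] f
          by (auto simp: fresh_def eval_nat_numeral)
        then show ?thesis by simp
      qed
    next
      assume "\<exists>n. m + 2 * i = n + 2 \<and> fresh n \<and> d (n + 4) = d (n + 1)"
      then obtain n where n: "m + 2 * i = n + 2" "fresh n" "d (n + 4) = d (n + 1)"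
        by blast
      have "fresh (n + 4)" using n(2) F3[OF n(2,3)] F2[OF n(2,3)] n(3)
        by (auto simp: fresh_def eval_nat_numeral)
      moreover have "m + 2 * Suc i = n + 4" using n(1) by simp
      ultimately show ?case by metis
    qed
  qed note inv = this
  have "d (m + 2 * i + 3) \<noteq> d (m + 2 * i + 2)" for i
    using inv[of i]
  proof
    assume "fresh (m + 2 * i)"
    then show ?thesis using F1[of "m + 2 * i"] by (auto simp: fresh_def)
  next
    assume "\<exists>n. m + 2 * i = n + 2 \<and> fresh n \<and> d (n + 4) = d (n + 1)"
    then obtain n where n: "m + 2 * i = n + 2" "fresh n" "d (n + 4) = d (n + 1)" by blast
    have "m + 2 * i + 3 = n + 5" "m + 2 * i + 2 = n + 4" using n(1) by simp_all
    then show ?thesis using F2[OF n(2,3)] by metis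
  qed
  then have "\<forall>i. tail (m + 2) d (Suc (2 * i)) \<noteq> tail (m + 2) d (2 * i)"
    by (auto simp: tail_def eval_nat_numeral)
  then show ?thesis unfolding theta_iff_switches by blast
qed


definition eventually_periodic :: "(nat \<Rightarrow> bool) \<Rightarrow> bool" where
  "eventually_periodic d \<longleftrightarrow> (\<exists>m p. p > 0 \<and> (\<forall>n\<ge>m. d (n + p) = d n))"

text \<open>Desubstitution halves the depth at which the comparison is decided. At depth 1 no switch
can occur, so the sequence is constant.\<close>

lemma strictly_bounded_eventually_periodic:
  assumes "tm_strictly_bounded (2 ^ k) d" shows "eventually_periodic d"
  using assms
proof (induction k arbitrary: d)
  case 0
  have "\<not> after d n 0" for n using 0 by (auto simp: tm_strictly_bounded_def lex_less_at_def)
  then have "\<forall>n\<ge>0. d (n + 1) = d n" by (auto simp: after_def)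
  then show ?case unfolding eventually_periodic_def by (intro exI[of _ 0] exI[of _ 1]) simp
next
  case (Suc k)
  have "tm_bounded K d" for K using Suc.prems by (rule tm_strictly_bounded_imp)
  from desubstitution[OF this] show ?case
  proof
    assume "d = (\<lambda>_. d 0)"
    then obtain b where "d = (\<lambda>_. b)" ..
    then have "\<forall>n\<ge>0. d (n + 1) = d n" by simp
    then show ?case unfolding eventually_periodic_def by (intro exI[of _ 0] exI[of _ 1]) simp
  next
    assume "\<exists>m e. tail m d = theta e"
    then obtain m e where me: "tail m d = theta e" by blast
    have "tm_strictly_bounded (2 * 2 ^ k) (theta e)"
      using tm_strictly_bounded_tail[OF Suc.prems, of m] me by simp
    then have "eventually_periodic e" by (rule Suc.IH[OF tm_strictly_bounded_theta_D])
    then obtain m' p where p: "p > 0" "\<And>n. n \<ge> m' \<Longrightarrow> e (n + p) = e n"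
      unfolding eventually_periodic_def by blast
    have "d (n + 2 * p) = d n" if n: "n \<ge> m + 2 * m'" for n
    proof -
      define j where "j = n - m"
      have j: "n = m + j" "j \<ge> 2 * m'" using n by (auto simp: j_def)
      have "d n = theta e j" "d (n + 2 * p) = theta e (j + 2 * p)"
        unfolding me[symmetric] by (auto simp: tail_def j add.assoc)
      moreover have "e (p + j div 2) = e (j div 2)" using p(2)[of "j div 2"] j by (simp add: add.commute)
      ultimately show ?thesis by (simp add: theta_def)
    qed
    then show ?case unfolding eventually_periodic_def using p(1)
      by (intro exI[of _ "m + 2 * m'"] exI[of _ "2 * p"]) simp
  qed
qed

text \<open>For fixed preperiod and period, a sequence is determined by a finite prefix.\<close>

lemma countable_eventually_periodic: "countable {d. eventually_periodic d}"
proof -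
  have c: "countable {d :: nat \<Rightarrow> bool. p > 0 \<and> (\<forall>n\<ge>m. d (n + p) = d n)}" for m p :: nat
  proof (rule countableI')
    show "inj_on (\<lambda>d. to_nat (map d [0..<m + p])) {d :: nat \<Rightarrow> bool. p > 0 \<and> (\<forall>n\<ge>m. d (n + p) = d n)}"
    proof (rule inj_onI, safe)
      fix d d' :: "nat \<Rightarrow> bool"
      assume "to_nat (map d [0..<m + p]) = to_nat (map d' [0..<m + p])" "p > 0"
        and P: "\<forall>n\<ge>m. d (n + p) = d n" "\<forall>n\<ge>m. d' (n + p) = d' n"
      then have ag: "d n = d' n" if "n < m + p" for n using that by (auto simp: map_eq_conv)
      have "d n = d' n" for n
      proof (induction n rule: less_induct)
        case (less n)
        show ?case
        proof (cases "n < m + p")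
          case False
          then have "d n = d (n - p)" "d' n = d' (n - p)"
            using P(1)[rule_format, of "n - p"] P(2)[rule_format, of "n - p"] by auto
          then show ?thesis using less[of "n - p"] \<open>p > 0\<close> False by auto
        qed (use ag in auto)
      qed
      then show "d = d'" by auto
    qed
  qed
  have "{d. eventually_periodic d} = (\<Union>m. \<Union>p. {d :: nat \<Rightarrow> bool. p > 0 \<and> (\<forall>n\<ge>m. d (n + p) = d n)})"
    by (auto simp: eventually_periodic_def)
  then show ?thesis using c by simp
qed

text \<open>Iterated desubstitution: the blocks are the \<open>k\<close>-fold images of the two letters, unless an
earlier step ends in a constant sequence, where both blocks may be taken equal.\<close>

lemma two_block_structure:
  assumes "\<And>K. tm_bounded K d"
  shows "\<exists>m u c. \<forall>i. \<forall>j<2 ^ k. d (m + i * 2 ^ k + j) = u (c i :: bool) j"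
  using assms
proof (induction k arbitrary: d)
  case 0
  show ?case by (intro exI[of _ 0] exI[of _ "\<lambda>b _. b"] exI[of _ d]) simp
next
  case (Suc k)
  from desubstitution[OF Suc.prems] show ?case
  proof
    assume "d = (\<lambda>_. d 0)"
    then obtain b where "d = (\<lambda>_. b)" ..
    then have "\<forall>i. \<forall>j<2 ^ Suc k. d (0 + i * 2 ^ Suc k + j) = b" by simp
    then show ?case by (intro exI[of _ 0] exI[of _ "\<lambda>_ _. b"] exI[of _ d])
  next
    assume "\<exists>m e. tail m d = theta e"
    then obtain m e where me: "tail m d = theta e" by blast
    have "tm_bounded K e" for K
      by (rule tm_bounded_theta_D) (metis me tm_bounded_tail[OF Suc.prems])
    from Suc.IH[OF this] obtain m' u c where
      u: "\<forall>i. \<forall>j<2 ^ k. e (m' + i * 2 ^ k + j) = u (c i :: bool) j" by blast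
    have "d (m + 2 * m' + i * 2 ^ Suc k + j) = (u (c i) (j div 2) \<noteq> odd j)" if "j < 2 ^ Suc k" for i j
    proof -
      have "d (m + 2 * m' + i * 2 ^ Suc k + j) = theta e (2 * m' + i * 2 ^ Suc k + j)"
        unfolding me[symmetric] by (simp add: tail_def add.assoc)
      also have "2 * m' + i * 2 ^ Suc k + j = j + 2 * (m' + i * 2 ^ k)" by simp
      also have "theta e \<dots> = (e (m' + i * 2 ^ k + j div 2) \<noteq> odd j)"
        unfolding theta_def by (subst div_mult_self2) (simp_all add: add.commute)
      also have "e (m' + i * 2 ^ k + j div 2) = u (c i) (j div 2)" using u that by simp
      finally show ?thesis .
    qed
    then show ?case
      by (intro exI[of _ "m + 2 * m'"] exI[of _ "\<lambda>b j. u b (j div 2) \<noteq> odd j"] exI[of _ c]) blast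
  qed
qed

section \<open>Uncountably many sequences bounded by Thue--Morse\<close>

text \<open>Doubling the first letter creates only one new comparison, and that one is trivial because
the complemented tail starts with 0.\<close>

lemma tm_bounded_prepend:
  assumes "e 0" "tm_bounded K e" shows "tm_bounded K (case_nat True e)"
  unfolding tm_bounded_def
proof (intro allI impI)
  fix n k assume "k < K"
  show "\<not> lex_less_at k tau (after (case_nat True e) n)"
  proof (cases n)
    case 0
    have "\<not> after (case_nat True e) n 0" using assms(1) by (simp add: 0 after_def)
    then show ?thesis using tau_0 by (metis lex_less_at_def not_gr0)
  next
    case (Suc n')
    have "after (case_nat True e) n = after e n'" by (simp add: Suc after_def fun_eq_iff)
    then show ?thesis using assms(2) \<open>k < K\<close> by (simp add: tm_bounded_def)
  qed
qed

text \<open>The recursion solves \<open>coded c = theta (1 coded c')\<close> or \<open>coded c = theta (coded c')\<close>, according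
to \<open>c 0\<close>, where \<open>c'\<close> is \<open>c\<close> without its first bit. Both right-hand sides start with 1, so the first letter can
be fixed in advance and every further letter refers to a smaller position.\<close>

function coded :: "(nat \<Rightarrow> bool) \<Rightarrow> nat \<Rightarrow> bool" where
  "coded c n = (if n = 0 then True else
     (if c 0 then (if n div 2 = 0 then True else coded (\<lambda>k. c (Suc k)) (n div 2 - 1))
      else coded (\<lambda>k. c (Suc k)) (n div 2)) \<noteq> odd n)"
  by auto
termination by (relation "Wellfounded.measure snd") auto
declare coded.simps [simp del]

lemma coded_0: "coded c 0" by (subst coded.simps) simp

lemma coded_theta:
  "coded c = theta (if c 0 then case_nat True (coded (\<lambda>k. c (Suc k))) else coded (\<lambda>k. c (Suc k)))"
proof
  fix n
  show "coded c n = theta (if c 0 then case_nat True (coded (\<lambda>k. c (Suc k))) else coded (\<lambda>k. c (Suc k))) n"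
    using coded.simps[of c n] coded_0[of "\<lambda>k. c (Suc k)"]
    by (auto simp: theta_def split: nat.splits)
qed

text \<open>Prepending a letter preserves the depth and the substitution increases it, so the depth
grows without bound although the recursion for \<open>coded\<close> has no base case.\<close>

lemma tm_bounded_coded: "tm_bounded K (coded c)"
proof (induction K arbitrary: c)
  case 0 show ?case by (simp add: tm_bounded_def)
next
  case (Suc K)
  define e where "e = (if c 0 then case_nat True (coded (\<lambda>k. c (Suc k))) else coded (\<lambda>k. c (Suc k)))"
  have "tm_bounded K e" unfolding e_def using Suc tm_bounded_prepend[OF coded_0 Suc] by simp
  then have "tm_bounded (2 * K + 1) (theta e)" by (rule tm_bounded_theta)
  then show ?case unfolding coded_theta[of c] e_def[symmetric] by (rule tm_bounded_mono) simp
qed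

lemma theta_inj: "theta e = theta e' \<Longrightarrow> e = e'"
proof
  fix i assume "theta e = theta e'"
  from fun_cong[OF this, of "2 * i"] show "e i = e' i" by (simp add: theta_def)
qed

text \<open>The bit \<open>c 0\<close> is the letter at position 2, and cancelling the outer substitution gives the
code of the remaining bits.\<close>

lemma inj_coded: "inj coded"
proof (rule injI)
  fix c c' :: "nat \<Rightarrow> bool"
  have two: "coded c 2 = c 0" for c
    using fun_cong[OF coded_theta[of c], of 2] fun_cong[OF coded_theta[of "\<lambda>k. c (Suc k)"], of 1] 
      coded_0[of "\<lambda>k. c (Suc k)"] coded_0[of "\<lambda>k. c (Suc (Suc k))"]
    by (auto simp: theta_def split: if_splits)
  have step: "coded (\<lambda>k. c (Suc k)) = coded (\<lambda>k. c' (Suc k))" if eq: "coded c = coded c'" for c c'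
  proof -
    have h: "c 0 = c' 0" using eq two by metis
    have "(if c 0 then case_nat True (coded (\<lambda>k. c (Suc k))) else coded (\<lambda>k. c (Suc k))) =
      (if c' 0 then case_nat True (coded (\<lambda>k. c' (Suc k))) else coded (\<lambda>k. c' (Suc k)))"
      by (rule theta_inj) (use eq coded_theta[of c] coded_theta[of c'] in argo)
    then have "case_nat True (coded (\<lambda>k. c (Suc k))) = case_nat True (coded (\<lambda>k. c' (Suc k))) \<or> ?thesis"
      using h by (auto split: if_splits)
    then show ?thesis
    proof
      assume "case_nat True (coded (\<lambda>k. c (Suc k))) = case_nat True (coded (\<lambda>k. c' (Suc k)))"
      from fun_cong[OF this, of "Suc n" for n] show ?thesis by auto
    qed
  qed
  assume eq: "coded c = coded c'"
  have "coded (\<lambda>k. c (n + k)) = coded (\<lambda>k. c' (n + k))" for n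
  proof (induction n)
    case (Suc n) from step[OF this] show ?case by simp
  qed (use eq in simp)
  then have "coded (\<lambda>k. c (n + k)) 2 = coded (\<lambda>k. c' (n + k)) 2" for n by simp
  then show "c = c'" unfolding two by auto
qed


section \<open>Univoque sequences in a real base\<close>

text \<open>The value in base \<open>1 / l\<close>, with the first digit behind the radix point.\<close>

definition val :: "real \<Rightarrow> (nat \<Rightarrow> bool) \<Rightarrow> real" where
  "val l d = (\<Sum>j. of_bool (d j) * l ^ Suc j)"

text \<open>Univoqueness is defined by the bound on the tails, which is what the comparison with \<open>tau\<close>
works with; its equivalence with uniqueness of the value in base \<open>1 / l\<close> for \<open>l \<ge> 1 / 2\<close> is
\<open>univoque_imp_unique\<close> together with \<open>unique_imp_univoque\<close>.\<close>

definition univoque :: "real \<Rightarrow> (nat \<Rightarrow> bool) \<Rightarrow> bool" where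
  "univoque l d \<longleftrightarrow> (\<forall>n. val l (after d n) < 1)"

text \<open>The tail of \<open>after d n\<close> behind position \<open>k\<close> is again of the form \<open>after d _\<close>, up to complement:
bounds on all \<open>after d n\<close> can be fed back into themselves.\<close>

lemma tail_after:
  "tail (Suc k) (after d n) = (if after d n k then (\<lambda>j. \<not> after d (Suc (n + k)) j) else after d (Suc (n + k)))"
  by (auto simp: tail_def after_def fun_eq_iff add.assoc)

lemma tail_Suc_eq: "tail (Suc n) d = (if d n then (\<lambda>j. \<not> after d n j) else after d n)"
  by (auto simp: tail_def after_def fun_eq_iff)

context
  fixes l :: real
  assumes l: "0 < l" "l < 1"
begin

lemma summable_val: "summable (\<lambda>j. of_bool (d j) * l ^ Suc j)"
proof (rule summable_comparison_test)
  show "\<exists>N. \<forall>n\<ge>N. norm (of_bool (d n) * l ^ Suc n) \<le> l ^ n"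
    using l by (intro exI[of _ 0]) (auto simp: mult_left_le_one_le)
  show "summable (\<lambda>n. l ^ n)" using l by simp
qed

lemma val_const_True: "val l (\<lambda>_. True) = l / (1 - l)"
proof -
  have "(\<lambda>j. l * l ^ j) sums (l * (1 / (1 - l)))"
    using l by (intro sums_mult geometric_sums) auto
  then show ?thesis by (simp add: val_def sums_iff)
qed

lemma val_nonneg: "0 \<le> val l d"
  unfolding val_def using l by (intro suminf_nonneg summable_val) auto

lemma val_not: "val l (\<lambda>j. \<not> d j) = l / (1 - l) - val l d"
proof -
  have "val l (\<lambda>j. \<not> d j) + val l d = val l (\<lambda>_. True)"
    unfolding val_def by (subst suminf_add[OF summable_val summable_val]) (auto intro!: suminf_cong)
  then show ?thesis by (simp add: val_const_True)
qed

lemma val_le: "val l d \<le> l / (1 - l)"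
  using val_not[of d] val_nonneg[of "\<lambda>j. \<not> d j"] by simp

lemma val_split: "val l d = (\<Sum>j<k. of_bool (d j) * l ^ Suc j) + l ^ k * val l (tail k d)"
proof -
  have "val l d = (\<Sum>n. of_bool (d (n + k)) * l ^ Suc (n + k)) + (\<Sum>j<k. of_bool (d j) * l ^ Suc j)"
    unfolding val_def by (rule suminf_split_initial_segment[OF summable_val])
  also have "(\<Sum>n. of_bool (d (n + k)) * l ^ Suc (n + k)) = (\<Sum>n. l ^ k * (of_bool (tail k d n) * l ^ Suc n))"
    by (intro suminf_cong) (simp add: tail_def add.commute power_add)
  also have "\<dots> = l ^ k * val l (tail k d)"
    unfolding val_def by (rule suminf_mult[OF summable_val])
  finally show ?thesis by simp
qed

lemma val_ge_power: "d k \<Longrightarrow> l ^ Suc k \<le> val l d"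
proof -
  assume "d k"
  have "val l d \<ge> (\<Sum>j<Suc k. of_bool (d j) * l ^ Suc j)"
    using val_split[of d "Suc k"] val_nonneg[of "tail (Suc k) d"] l by simp
  moreover have "(\<Sum>j<Suc k. of_bool (d j) * l ^ Suc j) \<ge> of_bool (d k) * l ^ Suc k"
    using l by (intro member_le_sum) auto
  ultimately show ?thesis using \<open>d k\<close> by simp
qed

text \<open>The key computation: sequences that first differ at position \<open>k\<close> have values that differ
by the unit of that position and the difference of the tails.\<close>

lemma val_diff:
  assumes "lex_less_at k x y"
  shows "val l y - val l x = l ^ Suc k * (1 + val l (tail (Suc k) y) - val l (tail (Suc k) x))"
proof -
  have "(\<Sum>j<k. of_bool (x j) * l ^ Suc j) = (\<Sum>j<k. of_bool (y j) * l ^ Suc j)"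
    using assms by (intro sum.cong) (auto simp: lex_less_at_def)
  then show ?thesis using assms
    unfolding val_split[of x "Suc k"] val_split[of y "Suc k"]
    by (simp add: lex_less_at_def algebra_simps)
qed

text \<open>At the first place where another sequence deviates, the gain or loss of one unit cannot be
compensated by the tails, since behind this place \<open>d\<close> (complemented if its digit there is 1) is worth less than this
unit.\<close>

lemma univoque_imp_unique:
  assumes "univoque l d" "val l d' = val l d" shows "d' = d"
proof -
  have "\<not> lex_less_at k d d'" for k
  proof
    assume L: "lex_less_at k d d'"
    then have "tail (Suc k) d = after d k" by (simp add: lex_less_at_def tail_Suc_eq)
    then have "val l (tail (Suc k) d) < 1" using assms(1) by (simp add: univoque_def)
    then have "0 < l ^ Suc k * (1 + val l (tail (Suc k) d') - val l (tail (Suc k) d))"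
      using val_nonneg[of "tail (Suc k) d'"] l by (intro mult_pos_pos) auto
    then show False unfolding val_diff[OF L, symmetric] assms(2) by simp
  qed
  moreover have "\<not> lex_less_at k d' d" for k
  proof
    assume L: "lex_less_at k d' d"
    then have "tail (Suc k) d = (\<lambda>j. \<not> after d k j)" by (simp add: lex_less_at_def tail_Suc_eq)
    then have "val l (tail (Suc k) d) > l / (1 - l) - 1"
      using assms(1) by (simp add: univoque_def val_not)
    then have "0 < l ^ Suc k * (1 + val l (tail (Suc k) d) - val l (tail (Suc k) d'))"
      using val_le[of "tail (Suc k) d'"] l by (intro mult_pos_pos) auto
    then show False unfolding val_diff[OF L, symmetric] assms(2) by simp
  qed
  ultimately show ?thesis using lex_trichotomy by metis
qed

text \<open>Greedy expansion. For \<open>l \<ge> 1 / 2\<close> the remainder never leaves \<open>[0, l / (1 - l)]\<close>.\<close>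

lemma expansion_exists:
  assumes "1 / 2 \<le> l" "0 \<le> x" "x \<le> l / (1 - l)"
  shows "\<exists>e. val l e = x"
proof -
  (* Remainders of the greedy algorithm, rescaled after each digit. *)
  define r where "r = rec_nat x (\<lambda>_ y. y / l - of_bool (y \<ge> l))"
  have r: "r 0 = x" "r (Suc n) = r n / l - of_bool (r n \<ge> l)" for n by (simp_all add: r_def)
  have one: "1 \<le> l / (1 - l)" using assms(1) l by (simp add: field_simps)
  have inv: "0 \<le> r n \<and> r n \<le> l / (1 - l)" for n
  proof (induction n)
    case (Suc n)
    show ?case
    proof (cases "r n \<ge> l")
      case True
      have "r n / l \<le> (l / (1 - l)) / l" using Suc l by (intro divide_right_mono) auto
      also have "\<dots> = l / (1 - l) + 1" using l by (simp add: field_simps)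
      finally show ?thesis using True l by (simp add: r)
    next
      case False
      then have "r n / l \<le> 1" "0 \<le> r n / l" using Suc l by (auto simp: field_simps)
      then show ?thesis using False one by (simp add: r)
    qed
  qed (use assms r in simp)
  define e where "e n \<longleftrightarrow> r n \<ge> l" for n
  have part: "(\<Sum>j<n. of_bool (e j) * l ^ Suc j) = x - l ^ n * r n" for n
  proof (induction n)
    case (Suc n)
    have "l ^ Suc n * r (Suc n) = l ^ n * r n - of_bool (e n) * l ^ Suc n"
      using l by (simp add: r e_def field_simps)
    then show ?case using Suc by simp
  qed (simp add: r)
  have "(\<lambda>n. l ^ n * r n) \<longlonglongrightarrow> 0"
  proof (rule tendsto_sandwich[where f = "\<lambda>_. 0" and h = "\<lambda>n. l ^ n * (l / (1 - l))"])
    show "\<forall>\<^sub>F n in sequentially. l ^ n * r n \<le> l ^ n * (l / (1 - l))"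
      using inv l by (intro always_eventually allI mult_left_mono) auto
    show "\<forall>\<^sub>F n in sequentially. 0 \<le> l ^ n * r n"
      using inv l by (intro always_eventually allI mult_nonneg_nonneg) auto
    show "(\<lambda>n. l ^ n * (l / (1 - l))) \<longlonglongrightarrow> 0"
      using l by (intro tendsto_mult_left_zero LIMSEQ_power_zero) auto
  qed auto
  from tendsto_diff[OF tendsto_const[of x] this]
  have "(\<lambda>n. \<Sum>j<n. of_bool (e j) * l ^ Suc j) \<longlonglongrightarrow> x"
    unfolding part by simp
  then have "val l e = x" unfolding val_def by (simp add: sums_def sums_unique[symmetric])
  then show ?thesis by blast
qed

text \<open>If some \<open>after d n\<close> has value at least 1, then the digit at \<open>n\<close> can be flipped and the tail
changed so as to compensate, the new tail being a greedy expansion.\<close>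

lemma unique_imp_univoque:
  assumes "1 / 2 \<le> l" and uniq: "\<And>d'. val l d' = val l d \<Longrightarrow> d' = d"
  shows "univoque l d"
  unfolding univoque_def
proof (rule allI, rule ccontr)
  fix n assume "\<not> val l (after d n) < 1"
  then have ge: "val l (after d n) \<ge> 1" by simp
  obtain e where e: "val l e = val l (after d n) - 1"
    using expansion_exists[of "val l (after d n) - 1"] assms(1) ge val_le[of "after d n"] by auto
  define d' where "d' j = (if j < n then d j else if j = n then \<not> d n else e (j - Suc n) \<noteq> d n)" for j
  have te: "tail (Suc n) d' = (if d n then (\<lambda>j. \<not> e j) else e)"
    by (auto simp: tail_def d'_def fun_eq_iff)
  have "val l d' = val l d"
  proof (cases "d n")
    case False
    then have "lex_less_at n d d'" by (auto simp: lex_less_at_def d'_def)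
    from val_diff[OF this] show ?thesis using False e unfolding te by (simp add: tail_Suc_eq)
  next
    case True
    then have "lex_less_at n d' d" by (auto simp: lex_less_at_def d'_def)
    from val_diff[OF this] show ?thesis using True e unfolding te by (simp add: tail_Suc_eq val_not)
  qed
  then have "d' = d" by (rule uniq)
  then have "d' n = d n" by simp
  then show False by (simp add: d'_def)
qed

text \<open>If \<open>after d n\<close> exceeded \<open>tau\<close>, then it would carry a 1 where \<open>tau\<close> has a 0. By univoqueness
at that digit, the digit together with what follows is worth more than any tail, so the value of
\<open>after d n\<close> would exceed that of \<open>tau\<close>.\<close>

lemma univoque_lex_less:
  assumes "univoque l d" "1 \<le> val l tau"
  shows "\<exists>k. lex_less_at k (after d n) tau"
proof -
  have "after d n \<noteq> tau" using assms unfolding univoque_def by (metis not_less)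
  moreover have "\<not> lex_less_at k tau (after d n)" for k
  proof
    assume L: "lex_less_at k tau (after d n)"
    then have "tail (Suc k) (after d n) = (\<lambda>j. \<not> after d (Suc (n + k)) j)"
      unfolding tail_after by (simp add: lex_less_at_def)
    then have "val l (tail (Suc k) (after d n)) > l / (1 - l) - 1"
      using assms(1) by (simp add: univoque_def val_not)
    then have "0 < l ^ Suc k * (1 + val l (tail (Suc k) (after d n)) - val l (tail (Suc k) tau))"
      using val_le[of "tail (Suc k) tau"] l by (intro mult_pos_pos) auto
    then show False using val_diff[OF L] assms unfolding univoque_def by (smt (verit))
  qed
  ultimately show ?thesis using lex_trichotomy by metis
qed

text \<open>If \<open>tau\<close> is worth more than 1, then already one of its finite prefixes is, and no
\<open>after d n\<close> can have this prefix.\<close>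

lemma univoque_strictly_bounded:
  assumes "1 < val l tau"
  shows "\<exists>k. \<forall>d. univoque l d \<longrightarrow> tm_strictly_bounded (2 ^ k) d"
proof -
  have "(\<lambda>n. \<Sum>j<n. of_bool (tau j) * l ^ Suc j) \<longlonglongrightarrow> val l tau"
    unfolding val_def by (rule summable_LIMSEQ[OF summable_val])
  from order_tendstoD(1)[OF this assms]
  obtain K where K: "\<And>n. n \<ge> K \<Longrightarrow> 1 < (\<Sum>j<n. of_bool (tau j) * l ^ Suc j)"
    unfolding eventually_sequentially by blast
  have "tm_strictly_bounded (2 ^ K) d" if u: "univoque l d" for d
    unfolding tm_strictly_bounded_def
  proof
    fix n
    obtain k where k: "lex_less_at k (after d n) tau"
      using univoque_lex_less[OF u] assms by force
    have "k < 2 ^ K"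
    proof (rule ccontr)
      assume "\<not> k < 2 ^ K"
      then have "K \<le> k" using less_exp[of K] by linarith
      have "(\<Sum>j<K. of_bool (tau j) * l ^ Suc j) = (\<Sum>j<K. of_bool (after d n j) * l ^ Suc j)"
        using k \<open>K \<le> k\<close> by (intro sum.cong) (auto simp: lex_less_at_def)
      also have "\<dots> \<le> val l (after d n)"
        using val_split[of "after d n" K] val_nonneg[of "tail K (after d n)"] l by simp
      also have "\<dots> < 1" using u by (simp add: univoque_def)
      finally show False using K[of K] by simp
    qed
    then show "\<exists>k<2 ^ K. lex_less_at k (after d n) tau" using k by blast
  qed
  then show ?thesis by blast
qed

lemma val_tail_tau_pos: "0 < val l (tail m tau)"
proof -
  have tp: "tm (2 ^ j)" for j
    by (induction j) (use tau_0 in \<open>auto simp: tm_double tau_def\<close>)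
  have "Suc (m + (2 ^ m - 1 - m)) = 2 ^ m" using less_exp[of m] by linarith
  then have "tail m tau (2 ^ m - 1 - m)" using tp[of m] by (simp add: tail_def tau_def)
  from val_ge_power[of "tail m tau", OF this] show ?thesis
    using l by (meson zero_less_power less_le_trans)
qed

text \<open>The converse comparison. Where \<open>after d n\<close> falls below \<open>tau\<close> at position \<open>k\<close>, it has a 0, so its
remaining part is \<open>after d (n + k + 1)\<close>. Hence the excess of its value over 1 is at most \<open>l\<close> times
the supremum \<open>S\<close> of all such excesses, and this contraction makes \<open>S\<close> nonpositive.\<close>

lemma lex_bounded_imp_univoque:
  assumes "val l tau \<le> 1"
    and B: "\<And>n. val l (after d n) < 1 \<or> (\<exists>k. lex_less_at k (after d n) tau)"
  shows "univoque l d"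
proof -
  define S where "S = (SUP n. val l (after d n))"
  have bdd: "bdd_above (range (\<lambda>n. val l (after d n)))"
    using val_le by (intro bdd_aboveI2)
  have S: "val l (after d n) \<le> S" for n
    unfolding S_def using bdd by (intro cSUP_upper) auto
  have step: "val l (after d n) \<le> 1 + l ^ Suc k * (val l (after d (Suc (n + k))) - 1 - val l (tail (Suc k) tau))"
    if "lex_less_at k (after d n) tau" for n k
  proof -
    have "tail (Suc k) (after d n) = after d (Suc (n + k))"
      using that unfolding tail_after by (simp add: lex_less_at_def)
    then show ?thesis using val_diff[OF that] assms(1) by (simp add: algebra_simps)
  qed
  have "S \<le> 1"
  proof (rule ccontr)
    assume "\<not> S \<le> 1"
    then have S1: "S > 1" by simp
    have "val l (after d n) \<le> 1 + l * (S - 1)" for n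
    proof (cases "val l (after d n) < 1")
      case True
      moreover have "0 \<le> l * (S - 1)" using S1 l by simp
      ultimately show ?thesis by linarith
    next
      case False
      then obtain k where k: "lex_less_at k (after d n) tau" using B by blast
      have "l ^ Suc k * (val l (after d (Suc (n + k))) - 1 - val l (tail (Suc k) tau)) \<le> l ^ Suc k * (S - 1)"
        using S[of "Suc (n + k)"] val_nonneg[of "tail (Suc k) tau"] l by (intro mult_left_mono) auto
      also have "\<dots> \<le> l * (S - 1)"
        using l S1 by (intro mult_right_mono) (auto simp: power_le_one mult_left_le)
      finally show ?thesis using step[OF k] by simp
    qed
    then have "S \<le> 1 + l * (S - 1)" unfolding S_def by (intro cSUP_least) auto
    moreover have "l * (S - 1) < 1 * (S - 1)" using l S1 by (intro mult_strict_right_mono) auto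
    ultimately show False by simp
  qed
  show ?thesis unfolding univoque_def
  proof
    fix n
    show "val l (after d n) < 1"
    proof (cases "val l (after d n) < 1")
      case False
      then obtain k where k: "lex_less_at k (after d n) tau" using B by blast
      have "l ^ Suc k * (val l (after d (Suc (n + k))) - 1 - val l (tail (Suc k) tau)) < 0"
        using S[of "Suc (n + k)"] \<open>S \<le> 1\<close> val_tail_tau_pos[of "Suc k"] l by (intro mult_pos_neg) auto
      then show ?thesis using step[OF k] by simp
    qed
  qed
qed

text \<open>If \<open>tau\<close> has value below 1, agreement with a long prefix of \<open>tau\<close> also keeps the value
below 1, whatever follows.\<close>

lemma tm_bounded_imp_univoque:
  assumes "val l tau < 1"
  shows "\<exists>K. \<forall>d. tm_bounded K d \<longrightarrow> univoque l d"
proof -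
  have "(\<lambda>n. l ^ n * (l / (1 - l))) \<longlonglongrightarrow> 0"
    using l by (intro tendsto_mult_left_zero LIMSEQ_power_zero) auto
  from order_tendstoD(2)[OF this, of "1 - val l tau"] assms
  obtain K where K: "l ^ K * (l / (1 - l)) < 1 - val l tau"
    unfolding eventually_sequentially by auto
  have "univoque l d" if b: "tm_bounded K d" for d
  proof (rule lex_bounded_imp_univoque)
    show "val l tau \<le> 1" using assms by simp
    fix n
    consider "after d n = tau" | k where "lex_less_at k (after d n) tau" | k where "lex_less_at k tau (after d n)"
      using lex_trichotomy by metis
    then show "val l (after d n) < 1 \<or> (\<exists>k. lex_less_at k (after d n) tau)"
    proof cases
      case 3
      then have "K \<le> k" using b unfolding tm_bounded_def by (meson not_le)
      then have "(\<Sum>j<K. of_bool (after d n j) * l ^ Suc j) = (\<Sum>j<K. of_bool (tau j) * l ^ Suc j)"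
        using 3 by (intro sum.cong) (auto simp: lex_less_at_def)
      also have "\<dots> \<le> val l tau"
        using val_split[of tau K] val_nonneg[of "tail K tau"] l by simp
      finally have "val l (after d n) \<le> val l tau + l ^ K * val l (tail K (after d n))"
        using val_split[of "after d n" K] by simp
      also have "\<dots> \<le> val l tau + l ^ K * (l / (1 - l))"
        using val_le l by (intro add_left_mono mult_left_mono) auto
      finally show ?thesis using K by simp
    qed (use assms in auto)
  qed
  then show ?thesis by blast
qed

lemma univoque_const: "univoque l (\<lambda>_. b)"
proof -
  have "val l (after (\<lambda>_. b) n) = 0" for n by (simp add: after_def val_def)
  then show ?thesis by (simp add: univoque_def)
qed

text \<open>A switch between \<open>n\<close> and \<open>n + 1\<close> bounds the value of the same tail from above (by the condition at \<open>n\<close>)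
and from below (by the condition at \<open>n + 1\<close>); the bounds are compatible only if \<open>l + l\<^sup>2 < 1\<close>,
that is, above the golden ratio.\<close>

lemma univoque_imp_const:
  assumes "1 \<le> l + l\<^sup>2" "univoque l d" shows "d = (\<lambda>_. d 0)"
proof (rule constant_if_no_switch, rule ccontr)
  fix n assume "d (Suc n) \<noteq> d n"
  then have a: "after d n 0" by (simp add: after_def)
  have "val l (after d n) = l + l * val l (tail 1 (after d n))"
    using val_split[of "after d n" 1] a by simp
  also have "tail 1 (after d n) = (\<lambda>j. \<not> after d (Suc n) j)"
    using tail_after[of 0 d n] a by simp
  also have "val l \<dots> = l / (1 - l) - val l (after d (Suc n))" by (rule val_not)
  finally have "val l (after d n) = l + l * (l / (1 - l) - val l (after d (Suc n)))" .
  moreover have "l * (l / (1 - l) - 1) < l * (l / (1 - l) - val l (after d (Suc n)))"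
    using assms(2) l by (intro mult_strict_left_mono) (auto simp: univoque_def)
  moreover have "1 \<le> l + l * (l / (1 - l) - 1)"
    using assms(1) l by (simp add: field_simps power2_eq_square)
  moreover have "val l (after d n) < 1" using assms(2) by (simp add: univoque_def)
  ultimately show False by simp
qed

text \<open>Sequences of the form \<open>0 \<dots> 0 1 0 1 0 \<dots>\<close>: the value of \<open>1 0 1 0 \<dots>\<close> is \<open>l / (1 - l\<^sup>2)\<close>, which is
below 1.\<close>

lemma infinite_univoque:
  assumes "l + l\<^sup>2 < 1" shows "infinite {d. univoque l d}"
proof -
  define a where "a N n \<longleftrightarrow> N \<le> n \<and> even (n - N)" for N n :: nat
  have "val l (a 0) = l + l * (l * val l (a 0))"
  proof -
    have "tail 2 (a 0) = a 0" by (auto simp: tail_def a_def)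
    then have "val l (a 0) = l + l * l * val l (a 0)"
      using val_split[of "a 0" 2] by (simp add: a_def eval_nat_numeral)
    then show ?thesis by simp
  qed
  then have "val l (a 0) * (1 - l\<^sup>2) = l" by (simp add: algebra_simps power2_eq_square)
  then have a0: "val l (a 0) < 1"
  proof -
    have "l\<^sup>2 < 1" using l by (simp add: power_less_one_iff)
    then have "val l (a 0) = l / (1 - l\<^sup>2)" using \<open>val l (a 0) * (1 - l\<^sup>2) = l\<close> by (simp add: field_simps)
    moreover have "l / (1 - l\<^sup>2) < 1" using assms \<open>l\<^sup>2 < 1\<close> by (simp add: divide_simps)
    ultimately show ?thesis by simp
  qed
  have aN: "val l (a N) < 1" for N
  proof -
    have "tail N (a N) = a 0" by (auto simp: tail_def a_def)
    then have "val l (a N) = l ^ N * val l (a 0)"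
      using val_split[of "a N" N] by (simp add: a_def)
    also have "\<dots> \<le> 1 * val l (a 0)"
      using l val_nonneg by (intro mult_right_mono) (auto simp: power_le_one)
    finally show ?thesis using a0 by simp
  qed
  have "after (a N) n = (if n < N then a (N - Suc n) else a 0)" for N n
    by (auto simp: after_def a_def fun_eq_iff Suc_diff_le)
  then have "univoque l (a N)" for N using aN a0 by (simp add: univoque_def)
  then have "range a \<subseteq> {d. univoque l d}" by auto
  moreover have "inj a"
  proof (rule injI)
    fix M N assume "a M = a N"
    then have "a M M = a N M" "a M N = a N N" by simp_all
    then show "M = N" by (auto simp: a_def)
  qed
  then have "infinite (range a)" by (simp add: finite_image_iff)
  ultimately show ?thesis using infinite_super by blast
qed

text \<open>At the critical base a sequence bounded by \<open>tau\<close> can fail to be univoque only if some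
\<open>after d n\<close> equals \<open>tau\<close>. Such a sequence is determined by \<open>n\<close> and a finite prefix, so only
countably many of the \<open>coded\<close> sequences are lost.\<close>

lemma uncountable_univoque:
  assumes "val l tau = 1" shows "uncountable {d. univoque l d}"
proof
  assume c: "countable {d. univoque l d}"
  define Z where "Z = {d :: nat \<Rightarrow> bool. \<exists>n. after d n = tau}"
  have "countable Z"
  proof -
    have "inj_on (\<lambda>d. to_nat (map d [0..<Suc n])) {d :: nat \<Rightarrow> bool. after d n = tau}" for n
    proof (rule inj_onI, safe)
      fix d d' :: "nat \<Rightarrow> bool"
      assume "to_nat (map d [0..<Suc n]) = to_nat (map d' [0..<Suc n])"
        and P: "after d n = tau" "after d' n = tau"
      then have ag: "d j = d' j" if "j < Suc n" for j using that by (auto simp: map_eq_conv simp del: upt_Suc)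
      have "d j = d' j" if "j \<ge> Suc n" for j
      proof -
        have "after d n (j - Suc n) = after d' n (j - Suc n)" using P by simp
        then show ?thesis using that ag[of n] by (auto simp: after_def)
      qed
      then show "d = d'" using ag by (auto simp: fun_eq_iff not_less) (metis not_less)+
    qed
    then have "countable {d :: nat \<Rightarrow> bool. after d n = tau}" for n by (rule countableI')
    moreover have "Z = (\<Union>n. {d. after d n = tau})" by (auto simp: Z_def)
    ultimately show ?thesis by simp
  qed
  moreover have "range coded \<subseteq> Z \<union> {d. univoque l d}"
  proof safe
    fix d c assume "coded c \<notin> Z"
    then have ne: "after (coded c) n \<noteq> tau" for n by (auto simp: Z_def)
    show "univoque l (coded c)"
    proof (rule lex_bounded_imp_univoque)
      fix n
      have "\<not> lex_less_at k tau (after (coded c) n)" for k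
        using tm_bounded_coded[of "Suc k" c] by (auto simp: tm_bounded_def)
      then show "val l (after (coded c) n) < 1 \<or> (\<exists>k. lex_less_at k (after (coded c) n) tau)"
        using ne lex_trichotomy by metis
    qed (use assms in simp)
  qed
  ultimately have "countable (range coded)"
    using c by (meson countable_Un countable_subset)
  then have "countable (UNIV :: (nat \<Rightarrow> bool) set)" using inj_coded by (simp add: countable_image_inj_eq)
  moreover have "uncountable (UNIV :: (nat \<Rightarrow> bool) set)"
  proof
    assume "countable (UNIV :: (nat \<Rightarrow> bool) set)"
    then obtain f :: "nat \<Rightarrow> nat \<Rightarrow> bool" where "range f = UNIV" using uncountable_def by blast
    then obtain n where "f n = (\<lambda>n. \<not> f n n)" by (metis UNIV_I image_iff)
    then have "f n n = (\<not> f n n)" by (rule fun_cong)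
    then show False by simp
  qed
  ultimately show False by blast
qed

end

lemma val_mono:
  assumes "0 < l" "l \<le> l'" "l' < 1" shows "val l d \<le> val l' d"
  unfolding val_def using assms
  by (intro suminf_le summable_val mult_left_mono power_mono) auto

lemma val_strict_mono_tau:
  assumes "0 < l" "l < l'" "l' < 1" shows "val l tau < val l' tau"
proof -
  have "l * val l (tail 1 tau) \<le> l' * val l' (tail 1 tau)"
    using assms val_mono[of l l'] val_nonneg[of l] by (intro mult_mono) auto
  then show ?thesis
    using val_split[of l tau 1] val_split[of l' tau 1] assms tau_0 by simp
qed

section \<open>The Komornik--Loreti constant\<close>

text \<open>In base 2 no sequence has value above 1, while in base 3/2 the first two digits of \<open>tau\<close> are already
worth 10/9.\<close>

lemma kl_root: "\<exists>l. 1 / 2 \<le> l \<and> l \<le> 2 / 3 \<and> val l tau = 1"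
proof -
  have eq: "val l tau = l * (\<Sum>j. of_bool (tau j) * l ^ j)" if "0 < l" "l < 1" for l
  proof -
    have "summable (\<lambda>j. of_bool (tau j) * l ^ j)"
      using summable_mult[OF summable_val[OF that, of tau], of "1 / l"] that by simp
    from suminf_mult[OF this, of l] show ?thesis
      unfolding val_def by (simp add: mult.left_commute)
  qed
  have sK: "summable (\<lambda>j. of_bool (tau j) * (3/4 :: real) ^ j)"
    using summable_mult[OF summable_val[of "3/4" tau], of "4 / 3"] by (simp add: mult.left_commute)
  have "continuous_on {1/2..2/3} (\<lambda>l :: real. l * (\<Sum>j. of_bool (tau j) * l ^ j))"
    by (intro continuous_at_imp_continuous_on ballI continuous_intros isCont_powser[OF sK]) auto
  then have "continuous_on {1/2..2/3} (\<lambda>l. val l tau)"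
    by (rule continuous_on_eq) (simp add: eq)
  moreover have "val (1/2) tau \<le> 1"
    using val_le[of "1/2" tau] by simp
  moreover have "1 \<le> val (2/3) tau"
    using val_split[of "2/3" tau 2] val_nonneg[of "2/3" "tail 2 tau"] tau_prefix
    by (simp add: eval_nat_numeral)
  ultimately show ?thesis using IVT'[of "\<lambda>l. val l tau" "1/2" 1 "2/3"] by auto
qed

lemma tm_sums_iff:
  assumes "x > 1"
  shows "(\<lambda>n. real (thue_morse n) * x powi (- int n)) sums 1 \<longleftrightarrow> val (1 / x) tau = 1"
proof -
  have "(\<lambda>n. real (thue_morse n) * x powi (- int n)) sums 1 \<longleftrightarrow>
      (\<lambda>n. real (thue_morse (Suc n)) * x powi (- int (Suc n))) sums 1"
    by (subst sums_Suc_iff) (simp add: thue_morse_eq tm_0)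
  also have "(\<lambda>n. real (thue_morse (Suc n)) * x powi (- int (Suc n))) = (\<lambda>n. of_bool (tau n) * (1 / x) ^ Suc n)"
    by (rule ext) (simp add: thue_morse_eq tau_def power_int_minus power_one_over divide_simps flip: power_Suc del: of_nat_Suc)
  also have "\<dots> sums 1 \<longleftrightarrow> val (1 / x) tau = 1"
    unfolding val_def using summable_val[of "1 / x" tau] assms
    by (auto simp: sums_iff)
  finally show ?thesis .
qed

lemma komornik_loreti: "3 / 2 \<le> komornik_loreti" "komornik_loreti \<le> 2" "val (1 / komornik_loreti) tau = 1"
proof -
  obtain l where l: "1 / 2 \<le> l" "l \<le> 2 / 3" "val l tau = 1" using kl_root by blast
  have "komornik_loreti = 1 / l"
    unfolding komornik_loreti_def
  proof (rule the_equality)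
    show "1 / l > 1 \<and> (\<lambda>n. real (thue_morse n) * (1 / l) powi (- int n)) sums 1"
      using l by (subst tm_sums_iff) auto
    fix x :: real
    assume "x > 1 \<and> (\<lambda>n. real (thue_morse n) * x powi (- int n)) sums 1"
    then have x: "x > 1" "val (1 / x) tau = 1" using tm_sums_iff by auto
    then have "1 / x = l"
      using l val_strict_mono_tau[of l "1 / x"] val_strict_mono_tau[of "1 / x" l]
      by (cases l "1 / x" rule: linorder_cases) auto
    then show "x = 1 / l" by auto
  qed
  moreover have "3 / 2 \<le> 1 / l" "1 / l \<le> 2" "val (1 / (1 / l)) tau = 1"
    using l by (auto simp: field_simps)
  ultimately show "3 / 2 \<le> komornik_loreti" "komornik_loreti \<le> 2" "val (1 / komornik_loreti) tau = 1"
    by simp_all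
qed


section \<open>Addresses and the attractor\<close>

definition sign_seqs :: "(nat \<Rightarrow> int) set" where
  "sign_seqs = {a. range a \<subseteq> {-1, 1}}"

lemma sign_seqsD: "a \<in> sign_seqs \<Longrightarrow> a j = -1 \<or> a j = 1"
  unfolding sign_seqs_def by blast

lemma sign_seqsI: "(\<And>j. a j = -1 \<or> a j = 1) \<Longrightarrow> a \<in> sign_seqs"
  unfolding sign_seqs_def by blast

definition unique_address :: "complex \<Rightarrow> (nat \<Rightarrow> int) \<Rightarrow> bool" where
  "unique_address \<kappa> a \<longleftrightarrow> a \<in> sign_seqs \<and>
     (\<forall>b\<in>sign_seqs. address_point \<kappa> b = address_point \<kappa> a \<longrightarrow> b = a)"

lemma compact_sign_seqs: "compact sign_seqs"
proof -
  have "sign_seqs = PiE UNIV (\<lambda>_. {-1, 1})"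
    by (auto simp: sign_seqs_def PiE_def Pi_def)
  moreover have "compactin (product_topology (\<lambda>_. euclidean) UNIV) (PiE UNIV (\<lambda>_ :: nat. {-1, 1 :: int}))"
    by (simp add: compactin_PiE finite_imp_compact)
  ultimately show ?thesis by (simp add: euclidean_product_topology)
qed

context
  fixes \<kappa> :: complex
  assumes k1: "norm \<kappa> < 1"
begin

lemma summable_norm_kappa: "summable (\<lambda>j. norm \<kappa> ^ j)"
  using k1 by simp

lemma norm_address_term: "a \<in> sign_seqs \<Longrightarrow> norm (of_int (a j) * \<kappa> ^ j) = norm \<kappa> ^ j"
  using sign_seqsD[of a j] by (auto simp: norm_mult norm_power)

lemma summable_address: "a \<in> sign_seqs \<Longrightarrow> summable (\<lambda>j. of_int (a j) * \<kappa> ^ j)"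
  by (rule summable_comparison_test[OF _ summable_norm_kappa]) (auto simp: norm_address_term)

lemma address_point_split:
  assumes "a \<in> sign_seqs"
  shows "address_point \<kappa> a = (\<Sum>j<n. of_int (a j) * \<kappa> ^ j) + \<kappa> ^ n * address_point \<kappa> (\<lambda>j. a (j + n))"
proof -
  have s: "(\<lambda>j. a (j + n)) \<in> sign_seqs" using assms by (auto simp: sign_seqs_def)
  have "address_point \<kappa> a = (\<Sum>j. of_int (a (j + n)) * \<kappa> ^ (j + n)) + (\<Sum>j<n. of_int (a j) * \<kappa> ^ j)"
    unfolding address_point_def by (rule suminf_split_initial_segment[OF summable_address[OF assms]])
  also have "(\<Sum>j. of_int (a (j + n)) * \<kappa> ^ (j + n)) = (\<Sum>j. \<kappa> ^ n * (of_int (a (j + n)) * \<kappa> ^ j))"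
    by (intro suminf_cong) (simp add: power_add)
  also have "\<dots> = \<kappa> ^ n * address_point \<kappa> (\<lambda>j. a (j + n))"
    unfolding address_point_def by (rule suminf_mult[OF summable_address[OF s]])
  finally show ?thesis by simp
qed

lemma norm_address_point:
  assumes "a \<in> sign_seqs" shows "norm (address_point \<kappa> a) \<le> 1 / (1 - norm \<kappa>)"
proof -
  have "norm (address_point \<kappa> a) \<le> (\<Sum>j. norm (of_int (a j) * \<kappa> ^ j))"
    unfolding address_point_def by (rule summable_norm) (simp add: norm_address_term[OF assms] k1)
  also have "\<dots> = 1 / (1 - norm \<kappa>)"
    using k1 by (simp add: norm_address_term[OF assms] suminf_geometric)
  finally show ?thesis .
qed

lemma dist_address_point:
  assumes "a \<in> sign_seqs" "b \<in> sign_seqs" "\<And>j. j < n \<Longrightarrow> a j = b j"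
  shows "dist (address_point \<kappa> a) (address_point \<kappa> b) \<le> norm \<kappa> ^ n * (2 / (1 - norm \<kappa>))"
proof -
  let ?s = "\<lambda>a j. a (j + n)"
  have s: "?s a \<in> sign_seqs" "?s b \<in> sign_seqs" using assms by (auto simp: sign_seqs_def)
  have "(\<Sum>j<n. of_int (a j) * \<kappa> ^ j) = (\<Sum>j<n. of_int (b j) * \<kappa> ^ j)"
    using assms(3) by (intro sum.cong) auto
  then have "address_point \<kappa> a - address_point \<kappa> b = \<kappa> ^ n * (address_point \<kappa> (?s a) - address_point \<kappa> (?s b))"
    unfolding address_point_split[OF assms(1), of n] address_point_split[OF assms(2), of n]
    by (simp add: algebra_simps)
  then have "dist (address_point \<kappa> a) (address_point \<kappa> b) = norm \<kappa> ^ n * norm (address_point \<kappa> (?s a) - address_point \<kappa> (?s b))"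
    by (simp add: dist_norm norm_mult norm_power)
  also have "norm (address_point \<kappa> (?s a) - address_point \<kappa> (?s b)) \<le> 2 / (1 - norm \<kappa>)"
    using norm_triangle_ineq4[of "address_point \<kappa> (?s a)" "address_point \<kappa> (?s b)"]
      norm_address_point[OF s(1)] norm_address_point[OF s(2)] by simp
  finally show ?thesis by (simp add: mult_left_mono)
qed

lemma continuous_on_address_point: "continuous_on sign_seqs (address_point \<kappa>)"
proof (rule uniform_limit_theorem)
  show "uniform_limit sign_seqs (\<lambda>n a. \<Sum>j<n. of_int (a j) * \<kappa> ^ j) (address_point \<kappa>) sequentially"
    unfolding address_point_def
    by (rule Weierstrass_m_test[OF _ summable_norm_kappa]) (simp add: norm_address_term)
  show "\<forall>\<^sub>F n in sequentially. continuous_on sign_seqs (\<lambda>a. \<Sum>j<n. of_int (a j) * \<kappa> ^ j)"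
    by (intro always_eventually allI continuous_intros continuous_on_product_coordinates[THEN continuous_on_subset]) auto
qed simp

text \<open>The set of all points with an address is compact as the continuous image of a product of
finite sets. Any other compact solution of the set equation coincides with it: iterating the
equation inwards produces an address of each of its points, and iterating it outwards from one of its
points approaches every point that has an address.\<close>

lemma attractor_eq: "attractor \<kappa> = address_point \<kappa> ` sign_seqs"
  unfolding attractor_def
proof (rule the_equality)
  let ?F = "\<lambda>A. (\<lambda>z. \<kappa> * z - 1) ` A \<union> (\<lambda>z. \<kappa> * z + 1) ` A"
  have step: "address_point \<kappa> a = of_int (a 0) + \<kappa> * address_point \<kappa> (\<lambda>j. a (Suc j))" if "a \<in> sign_seqs" for a
    using address_point_split[OF that, of 1] by simp
  have "compact (address_point \<kappa> ` sign_seqs)"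
    using continuous_on_address_point compact_sign_seqs by (rule compact_continuous_image)
  moreover have "(\<lambda>_. 1) \<in> sign_seqs" by (simp add: sign_seqs_def)
  moreover have "address_point \<kappa> ` sign_seqs = ?F (address_point \<kappa> ` sign_seqs)"
  proof (intro subset_antisym subsetI)
    fix z assume "z \<in> address_point \<kappa> ` sign_seqs"
    then obtain a where a: "a \<in> sign_seqs" "z = address_point \<kappa> a" by blast
    have "(\<lambda>j. a (Suc j)) \<in> sign_seqs" using a by (auto simp: sign_seqs_def)
    then show "z \<in> ?F (address_point \<kappa> ` sign_seqs)"
      using step[OF a(1)] a(2) sign_seqsD[OF a(1), of 0] by (auto simp: image_iff)
  next
    fix z assume "z \<in> ?F (address_point \<kappa> ` sign_seqs)"
    then obtain a where a': "a \<in> sign_seqs" "z = \<kappa> * address_point \<kappa> a - 1 \<or> z = \<kappa> * address_point \<kappa> a + 1" by blast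
    from a'(2) have "\<exists>s :: int. (s = -1 \<or> s = 1) \<and> z = of_int s + \<kappa> * address_point \<kappa> a"
    proof
      assume "z = \<kappa> * address_point \<kappa> a - 1"
      then show ?thesis by (intro exI[of _ "-1"]) simp
    next
      assume "z = \<kappa> * address_point \<kappa> a + 1"
      then show ?thesis by (intro exI[of _ 1]) simp
    qed
    with a'(1) obtain s :: int where a: "s = -1 \<or> s = 1" "a \<in> sign_seqs" "z = of_int s + \<kappa> * address_point \<kappa> a"
      by blast
    have cs: "case_nat s a \<in> sign_seqs" using a sign_seqsD[OF a(2)] by (intro sign_seqsI) (auto split: nat.split)
    have "z = address_point \<kappa> (case_nat s a)" using step[OF cs] a by simp
    then show "z \<in> address_point \<kappa> ` sign_seqs" using cs by blast
  qed
  ultimately show "compact (address_point \<kappa> ` sign_seqs) \<and> address_point \<kappa> ` sign_seqs \<noteq> {} \<and>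
      address_point \<kappa> ` sign_seqs = ?F (address_point \<kappa> ` sign_seqs)" by blast
next
  fix A assume A: "compact A \<and> A \<noteq> {} \<and> A = (\<lambda>z. \<kappa> * z - 1) ` A \<union> (\<lambda>z. \<kappa> * z + 1) ` A"
  then have "bounded A" "closed A" by (auto simp: compact_imp_bounded compact_imp_closed)
  then obtain B where B: "\<And>z. z \<in> A \<Longrightarrow> norm z \<le> B" by (auto simp: bounded_iff)
  have lim0: "(\<lambda>n. \<kappa> ^ n * z n) \<longlonglongrightarrow> 0" if "\<And>n. z n \<in> A" for z
  proof (rule Lim_null_comparison)
    show "\<forall>\<^sub>F n in sequentially. norm (\<kappa> ^ n * z n) \<le> norm \<kappa> ^ n * B"
      using B that by (intro always_eventually allI) (auto simp: norm_mult norm_power intro!: mult_left_mono)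
    show "(\<lambda>n. norm \<kappa> ^ n * B) \<longlonglongrightarrow> 0"
      using k1 by (intro tendsto_mult_left_zero LIMSEQ_power_zero) auto
  qed
  show "A = address_point \<kappa> ` sign_seqs"
  proof (intro subset_antisym subsetI)
    fix w assume "w \<in> A"
    have "\<forall>z\<in>A. \<exists>s z'. (s = -1 \<or> s = (1 :: int)) \<and> z' \<in> A \<and> z = of_int s + \<kappa> * z'"
    proof
      fix z assume "z \<in> A"
      then have "z \<in> (\<lambda>z. \<kappa> * z - 1) ` A \<union> (\<lambda>z. \<kappa> * z + 1) ` A" using A by auto
      then show "\<exists>s z'. (s = -1 \<or> s = (1 :: int)) \<and> z' \<in> A \<and> z = of_int s + \<kappa> * z'"
      proof
        assume "z \<in> (\<lambda>z. \<kappa> * z - 1) ` A"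
        then obtain z' where "z' \<in> A" "z = \<kappa> * z' - 1" by blast
        then show ?thesis by (intro exI[of _ "-1 :: int"] exI[of _ z'] conjI) auto
      next
        assume "z \<in> (\<lambda>z. \<kappa> * z + 1) ` A"
        then obtain z' where "z' \<in> A" "z = \<kappa> * z' + 1" by blast
        then show ?thesis by (intro exI[of _ "1 :: int"] exI[of _ z'] conjI) auto
      qed
    qed
    then obtain s t where st: "\<And>z. z \<in> A \<Longrightarrow> s z = -1 \<or> s z = (1::int)" "\<And>z. z \<in> A \<Longrightarrow> t z \<in> A"
      "\<And>z. z \<in> A \<Longrightarrow> z = of_int (s z) + \<kappa> * t z" by metis
    define z where "z n = (t ^^ n) w" for n
    have zA: "z n \<in> A" for n by (induction n) (auto simp: z_def \<open>w \<in> A\<close> st)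
    define a where "a n = s (z n)" for n
    have a: "a \<in> sign_seqs" using st(1) zA by (auto simp: sign_seqs_def a_def)
    have part: "(\<Sum>j<n. of_int (a j) * \<kappa> ^ j) = w - \<kappa> ^ n * z n" for n
    proof (induction n)
      case (Suc n)
      have "z n = of_int (a n) + \<kappa> * z (Suc n)" using st(3)[OF zA[of n]] by (simp add: a_def z_def)
      then have "\<kappa> ^ n * z n = of_int (a n) * \<kappa> ^ n + \<kappa> ^ Suc n * z (Suc n)"
        by (simp add: algebra_simps)
      then show ?case using Suc by simp
    qed (simp add: z_def)
    from tendsto_diff[OF tendsto_const[of w] lim0[OF zA]]
    have "(\<lambda>n. \<Sum>j<n. of_int (a j) * \<kappa> ^ j) \<longlonglongrightarrow> w" unfolding part by simp
    then have "address_point \<kappa> a = w" unfolding address_point_def by (simp add: sums_def sums_unique[symmetric])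
    then show "w \<in> address_point \<kappa> ` sign_seqs" using a by blast
  next
    fix w assume "w \<in> address_point \<kappa> ` sign_seqs"
    then obtain a where a: "a \<in> sign_seqs" "w = address_point \<kappa> a" by blast
    obtain z where z: "z \<in> A" using A by blast
    have inA: "(\<Sum>j<n. of_int (a j) * \<kappa> ^ j) + \<kappa> ^ n * z \<in> A" if "a \<in> sign_seqs" for n a
      using that
    proof (induction n arbitrary: a)
      case (Suc n)
      have "(\<lambda>j. a (Suc j)) \<in> sign_seqs" using Suc.prems by (auto simp: sign_seqs_def)
      from Suc.IH[OF this] have y: "(\<Sum>j<n. of_int (a (Suc j)) * \<kappa> ^ j) + \<kappa> ^ n * z \<in> A" (is "?y \<in> A") .
      have "(\<Sum>j<Suc n. of_int (a j) * \<kappa> ^ j) + \<kappa> ^ Suc n * z = of_int (a 0) + \<kappa> * ?y"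
        unfolding sum.lessThan_Suc_shift by (simp add: algebra_simps sum_distrib_left)
      moreover have "of_int (a 0) + \<kappa> * ?y \<in> (\<lambda>z. \<kappa> * z - 1) ` A \<union> (\<lambda>z. \<kappa> * z + 1) ` A"
        using sign_seqsD[OF Suc.prems, of 0] y by (auto simp: image_iff)
      ultimately show ?case using A by simp
    qed (use z in simp)
    have "(\<lambda>n. (\<Sum>j<n. of_int (a j) * \<kappa> ^ j) + \<kappa> ^ n * z) \<longlonglongrightarrow> w + 0"
      using lim0[of "\<lambda>_. z"] z summable_LIMSEQ[OF summable_address[OF a(1)]]
      by (intro tendsto_add) (auto simp: a(2) address_point_def)
    then have "(\<lambda>n. (\<Sum>j<n. of_int (a j) * \<kappa> ^ j) + \<kappa> ^ n * z) \<longlonglongrightarrow> w" by simp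
    then show "w \<in> A" by (rule closed_sequentially[OF \<open>closed A\<close> inA[OF a(1)]])
  qed
qed

lemma uniqueness_set_eq: "uniqueness_set \<kappa> = address_point \<kappa> ` {a. unique_address \<kappa> a}"
proof -
  have "(\<exists>!b. is_address \<kappa> b (address_point \<kappa> a)) \<longleftrightarrow> unique_address \<kappa> a" if "a \<in> sign_seqs" for a
    using that unfolding unique_address_def is_address_def sign_seqs_def by blast
  moreover have "unique_address \<kappa> a \<Longrightarrow> a \<in> sign_seqs" for a by (simp add: unique_address_def)
  ultimately show ?thesis unfolding uniqueness_set_def attractor_eq by blast
qed

end

section \<open>Separating the residues modulo the period of the argument\<close>

text \<open>Every digit maximizes the imaginary part of its term, and it is the only digit that does so
unless the power of \<open>\<kappa>\<close> is real.\<close>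

definition extremal :: "complex \<Rightarrow> nat \<Rightarrow> int" where
  "extremal \<kappa> j = (if 0 < Im (\<kappa> ^ j) then 1 else -1)"

text \<open>What is used of \<open>\<kappa>\<close>: its \<open>m\<close>-th power is real with sign \<open>\<sigma>\<close>, and no power whose exponent is
not a multiple of \<open>m\<close> is real.\<close>

locale rational_rotation =
  fixes \<kappa> :: complex and m :: nat and l :: real and \<sigma> :: int
  assumes l: "0 < l" "l < 1" and m: "0 < m" and sigma: "\<sigma> = -1 \<or> \<sigma> = 1"
    and kappa_m: "\<kappa> ^ m = of_real (of_int \<sigma> * l)"
    and nonreal: "\<And>j. \<not> m dvd j \<Longrightarrow> Im (\<kappa> ^ j) \<noteq> 0"
begin

text \<open>The factor \<open>\<sigma> ^ k\<close> absorbs the sign of \<open>\<kappa> ^ (k * m)\<close>, so that the digits belong to the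
positive base \<open>1 / l\<close>.\<close>

definition residue_digits :: "nat \<Rightarrow> (nat \<Rightarrow> int) \<Rightarrow> nat \<Rightarrow> bool" where
  "residue_digits r a k \<longleftrightarrow> \<sigma> ^ k * a (k * m + r) = 1"

definition assemble :: "(nat \<Rightarrow> nat \<Rightarrow> bool) \<Rightarrow> nat \<Rightarrow> int" where
  "assemble D j = \<sigma> ^ (j div m) * (if D (j mod m) (j div m) then 1 else -1)"

definition replace :: "nat \<Rightarrow> (nat \<Rightarrow> bool) \<Rightarrow> (nat \<Rightarrow> int) \<Rightarrow> nat \<Rightarrow> int" where
  "replace r d a = assemble ((\<lambda>r. residue_digits r a)(r := d))"

lemma sigma_power: "\<sigma> ^ k = -1 \<or> \<sigma> ^ k = 1" and sigma_power_sq: "\<sigma> ^ k * \<sigma> ^ k = 1"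
proof -
  show *: "\<sigma> ^ k = -1 \<or> \<sigma> ^ k = 1" using sigma by (induction k) auto
  show "\<sigma> ^ k * \<sigma> ^ k = 1" using * by auto
qed

lemma norm_kappa_m: "norm \<kappa> ^ m = l"
proof -
  have "norm \<kappa> ^ m = norm (\<kappa> ^ m)" by (simp add: norm_power)
  then show ?thesis using kappa_m sigma l by (auto simp: norm_mult)
qed

lemma norm_kappa: "norm \<kappa> < 1"
proof (rule ccontr)
  assume "\<not> norm \<kappa> < 1"
  then have "1 \<le> norm \<kappa> ^ m" by (simp add: one_le_power)
  then show False using norm_kappa_m l by simp
qed

lemma assemble_sign: "assemble D \<in> sign_seqs"
  using sigma_power by (intro sign_seqsI) (auto simp: assemble_def)

lemma residue_digits_assemble: "r < m \<Longrightarrow> residue_digits r (assemble D) = D r"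
proof
  fix k assume "r < m"
  then have "(k * m + r) div m = k" "(k * m + r) mod m = r" by auto
  then show "residue_digits r (assemble D) k = D r k"
    using sigma_power[of k] by (auto simp: residue_digits_def assemble_def)
qed

lemma assemble_residue_digits:
  assumes "a \<in> sign_seqs" shows "assemble (\<lambda>r. residue_digits r a) = a"
proof
  fix j
  show "assemble (\<lambda>r. residue_digits r a) j = a j"
    using sigma_power[of "j div m"] sign_seqsD[OF assms, of j]
    by (auto simp: assemble_def residue_digits_def)
qed

lemma assemble_cong: "(\<And>r. r < m \<Longrightarrow> D r = D' r) \<Longrightarrow> assemble D = assemble D'"
  using m by (auto simp: assemble_def fun_eq_iff)

lemma replace_sign: "replace r d a \<in> sign_seqs"
  by (simp add: replace_def assemble_sign)

lemma replace_other:
  assumes "a \<in> sign_seqs" "j mod m \<noteq> r" shows "replace r d a j = a j"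
  using fun_cong[OF assemble_residue_digits[OF assms(1)], of j] assms(2)
  by (simp add: replace_def assemble_def)

lemma residue_digits_replace: "r < m \<Longrightarrow> residue_digits r (replace r d a) = d"
  by (simp add: replace_def residue_digits_assemble)

text \<open>Addresses that differ in a single residue class differ by a real expansion in base
\<open>1 / l\<close>; the factor 2 comes from passing from digits \<open>\<plusminus> 1\<close> to digits 0 and 1.\<close>

lemma address_point_diff:
  assumes a: "a \<in> sign_seqs" and b: "b \<in> sign_seqs" and r: "r < m"
    and eq: "\<And>j. j mod m \<noteq> r \<Longrightarrow> a j = b j"
  shows "address_point \<kappa> a - address_point \<kappa> b =
    \<kappa> ^ r * of_real (2 / l * (val l (residue_digits r a) - val l (residue_digits r b)))"
proof -
  let ?f = "\<lambda>j. of_int (a j) * \<kappa> ^ j - of_int (b j) * \<kappa> ^ j"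
  let ?da = "residue_digits r a" and ?db = "residue_digits r b"
  have sf: "?f sums (address_point \<kappa> a - address_point \<kappa> b)"
    unfolding address_point_def using summable_address[OF norm_kappa a] summable_address[OF norm_kappa b]
    by (intro sums_diff summable_sums)
  have "strict_mono (\<lambda>k. k * m + r)" using m by (auto simp: strict_mono_def)
  moreover have "?f j = 0" if "j \<notin> range (\<lambda>k. k * m + r)" for j
  proof -
    have "j mod m \<noteq> r" using that div_mult_mod_eq[of j m] by (metis rangeI)
    then show ?thesis using eq by simp
  qed
  ultimately have "(\<lambda>k. ?f (k * m + r)) sums (address_point \<kappa> a - address_point \<kappa> b)"
    using sf by (subst sums_mono_reindex) auto
  moreover have "?f (k * m + r) = \<kappa> ^ r * of_real (2 / l * (of_bool (?da k) * l ^ Suc k - of_bool (?db k) * l ^ Suc k))" for k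
  proof -
    have "of_int (a (k * m + r)) - of_int (b (k * m + r)) = (2 * of_int (\<sigma> ^ k) * (of_bool (?da k) - of_bool (?db k)) :: complex)"
      using sigma_power[of k] sign_seqsD[OF a, of "k * m + r"] sign_seqsD[OF b, of "k * m + r"]
      by (auto simp: residue_digits_def simp del: of_int_power)
    moreover have "\<kappa> ^ (k * m + r) = \<kappa> ^ r * (of_int (\<sigma> ^ k) * of_real l ^ k)"
      unfolding power_add by (simp add: mult.commute[of k] power_mult kappa_m power_mult_distrib)
    ultimately have "?f (k * m + r) = (2 * of_int (\<sigma> ^ k) * (of_bool (?da k) - of_bool (?db k))) * (\<kappa> ^ r * (of_int (\<sigma> ^ k) * of_real l ^ k))"
      by (simp flip: left_diff_distrib)
    also have "\<dots> = of_int (\<sigma> ^ k * \<sigma> ^ k) * (\<kappa> ^ r * (2 * (of_bool (?da k) - of_bool (?db k)) * of_real l ^ k))"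
      by (simp only: of_int_mult mult_ac)
    also have "\<dots> = \<kappa> ^ r * of_real (2 / l * (of_bool (?da k) * l ^ Suc k - of_bool (?db k) * l ^ Suc k))"
      using l unfolding sigma_power_sq by simp
    finally show ?thesis .
  qed
  moreover have "(\<lambda>k. \<kappa> ^ r * of_real (2 / l * (of_bool (?da k) * l ^ Suc k - of_bool (?db k) * l ^ Suc k))) sums
      (\<kappa> ^ r * of_real (2 / l * (val l ?da - val l ?db)))"
    unfolding val_def
    by (intro sums_mult sums_of_real sums_diff summable_sums summable_val l)
  ultimately show ?thesis by (simp only: sums_unique2)
qed

lemma extremal_sign: "extremal \<kappa> \<in> sign_seqs"
  by (intro sign_seqsI) (simp add: extremal_def)

text \<open>The extremal digits are forced since they alone attain the maximal imaginary part, the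
contribution of residue 0 being real. The remaining freedom lies in residue 0, where \<open>d\<close> is
univoque.\<close>

lemma unique_address_replace:
  assumes "univoque l d" shows "unique_address \<kappa> (replace 0 d (extremal \<kappa>))"
  unfolding unique_address_def
proof (intro conjI ballI impI replace_sign)
  let ?a = "replace 0 d (extremal \<kappa>)"
  fix b assume b: "b \<in> sign_seqs" and eq: "address_point \<kappa> b = address_point \<kappa> ?a"
  have ae: "?a j = extremal \<kappa> j" if "\<not> m dvd j" for j
    using replace_other[OF extremal_sign, of j 0 d] that by (simp add: dvd_eq_mod_eq_0)
  have offm: "?a j = b j" if nd: "\<not> m dvd j" for j
  proof -
    (* Making \<open>b\<close> agree with \<open>?a\<close> in residue 0 changes the point by a real number only. *)
    let ?b = "replace 0 (residue_digits 0 ?a) b"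
    let ?g = "\<lambda>j. Im (of_int (?a j) * \<kappa> ^ j - of_int (?b j) * \<kappa> ^ j)"
    have bs: "?b \<in> sign_seqs" by (rule replace_sign)
    have bo: "?b j = b j" if "\<not> m dvd j" for j
      using replace_other[OF b, of j 0] that by (simp add: dvd_eq_mod_eq_0)
    have ao: "?b j = ?a j" if "m dvd j" for j
      using that by (simp add: replace_def assemble_def residue_digits_assemble m dvd_eq_mod_eq_0)
    have "address_point \<kappa> b - address_point \<kappa> ?b \<in> \<real>"
      using address_point_diff[OF b bs m] replace_other[OF b, of _ 0] by simp
    then have "Im (address_point \<kappa> ?a) = Im (address_point \<kappa> ?b)"
      unfolding eq by (simp add: complex_is_Real_iff)
    moreover have "?g sums Im (address_point \<kappa> ?a - address_point \<kappa> ?b)"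
      unfolding address_point_def using summable_address[OF norm_kappa replace_sign] summable_address[OF norm_kappa bs]
      by (intro sums_Im sums_diff summable_sums)
    ultimately have g0: "?g sums 0" by simp
    have nn: "0 \<le> ?g j" for j
    proof (cases "m dvd j")
      case False
      then show ?thesis using sign_seqsD[OF bs, of j] by (auto simp: ae extremal_def)
    qed (simp add: ao)
    have "\<forall>j. ?g j = 0"
      using suminf_eq_zero_iff[of ?g] g0 nn by (simp add: sums_iff)
    then have "of_int (?a j - ?b j) * Im (\<kappa> ^ j) = 0" by (simp add: left_diff_distrib)
    then show ?thesis using nonreal[OF nd] bo[OF nd] by simp
  qed
  have "0 = \<kappa> ^ 0 * of_real (2 / l * (val l (residue_digits 0 b) - val l (residue_digits 0 ?a)))"
    using address_point_diff[OF b replace_sign[of 0 d "extremal \<kappa>"] m] offm eq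
    by (simp add: dvd_eq_mod_eq_0)
  then have "val l (residue_digits 0 b) = val l d"
    using l by (simp add: residue_digits_replace m)
  then have d: "residue_digits 0 b = residue_digits 0 ?a"
    using univoque_imp_unique[OF l assms] by (simp add: residue_digits_replace m)
  show "b = ?a"
  proof
    fix j
    show "b j = ?a j"
    proof (cases "m dvd j")
      case True
      then have "assemble (\<lambda>r. residue_digits r b) j = assemble (\<lambda>r. residue_digits r ?a) j"
        using d by (simp add: assemble_def dvd_eq_mod_eq_0)
      then show ?thesis by (simp add: assemble_residue_digits b replace_sign)
    qed (use offm in simp)
  qed
qed

text \<open>A second expansion of the real number in one residue class gives a second address of the
same point.\<close>

lemma unique_address_residue_univoque:
  assumes "unique_address \<kappa> a" "r < m" "1 / 2 \<le> l"
  shows "univoque l (residue_digits r a)"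
proof (rule unique_imp_univoque[OF l assms(3)])
  fix d assume d: "val l d = val l (residue_digits r a)"
  have a: "a \<in> sign_seqs" using assms(1) by (simp add: unique_address_def)
  have "address_point \<kappa> (replace r d a) - address_point \<kappa> a = 0"
    using address_point_diff[OF replace_sign a assms(2)] replace_other[OF a] d
    by (simp add: residue_digits_replace assms(2))
  then have "replace r d a = a"
    using assms(1) replace_sign by (simp add: unique_address_def)
  then show "d = residue_digits r a" using residue_digits_replace[OF assms(2), of d a] by simp
qed

lemma unique_addresses_subset:
  assumes "1 / 2 \<le> l"
  shows "{a. unique_address \<kappa> a} \<subseteq> (\<lambda>L. assemble (\<lambda>r. L ! r)) ` {L. set L \<subseteq> {d. univoque l d} \<and> length L = m}"
proof
  fix a assume "a \<in> {a. unique_address \<kappa> a}"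
  then have u: "unique_address \<kappa> a" by simp
  let ?L = "map (\<lambda>r. residue_digits r a) [0..<m]"
  have "a = assemble (\<lambda>r. residue_digits r a)"
    using assemble_residue_digits u by (simp add: unique_address_def)
  also have "\<dots> = assemble (\<lambda>r. ?L ! r)" by (rule assemble_cong) simp
  finally have "a = assemble (\<lambda>r. ?L ! r)" .
  moreover have "set ?L \<subseteq> {d. univoque l d}"
    using unique_address_residue_univoque[OF u _ assms] by auto
  ultimately show "a \<in> (\<lambda>L. assemble (\<lambda>r. L ! r)) ` {L. set L \<subseteq> {d. univoque l d} \<and> length L = m}"
    by (intro image_eqI[of _ _ ?L]) auto
qed

text \<open>These points lie on a line that supports the attractor.\<close>

definition face_point :: "(nat \<Rightarrow> bool) \<Rightarrow> complex" where
  "face_point d = address_point \<kappa> (replace 0 d (extremal \<kappa>))"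

lemma face_point_in: "univoque l d \<Longrightarrow> face_point d \<in> uniqueness_set \<kappa>"
  unfolding uniqueness_set_eq[OF norm_kappa] face_point_def using unique_address_replace by blast

lemma dist_face_point: "dist (face_point d) (face_point d') = 2 / l * \<bar>val l d - val l d'\<bar>"
proof -
  have "face_point d - face_point d' = \<kappa> ^ 0 * of_real (2 / l * (val l d - val l d'))"
    unfolding face_point_def using m
    by (subst address_point_diff[of _ _ 0])
       (auto simp: replace_sign replace_other[OF extremal_sign] residue_digits_replace)
  then have "face_point d - face_point d' = of_real (2 / l * (val l d - val l d'))" by simp
  then show ?thesis unfolding dist_norm using l by (simp only: norm_of_real abs_mult) simp
qed

lemma inj_on_face_point: "inj_on face_point {d. univoque l d}"
proof (rule inj_onI)
  fix d d' assume "d \<in> {d. univoque l d}" "d' \<in> {d. univoque l d}" "face_point d = face_point d'"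
  then have "univoque l d'" "val l d = val l d'" using dist_face_point[of d d'] l by auto
  then show "d = d'" by (rule univoque_imp_unique[OF l])
qed

lemma finite_uniqueness_set:
  assumes "1 / 2 \<le> l" "finite {d. univoque l d}" shows "finite (uniqueness_set \<kappa>)"
  unfolding uniqueness_set_eq[OF norm_kappa] using unique_addresses_subset[OF assms(1)]
  by (rule finite_imageI[OF finite_subset]) (intro finite_imageI finite_lists_length_eq assms)

lemma countable_uniqueness_set:
  assumes "1 / 2 \<le> l" "countable {d. univoque l d}" shows "countable (uniqueness_set \<kappa>)"
proof -
  have "countable {L. set L \<subseteq> {d. univoque l d} \<and> length L = m}"
    by (rule countable_subset[OF _ countable_lists[OF assms(2)]]) auto
  then show ?thesis
    unfolding uniqueness_set_eq[OF norm_kappa] using unique_addresses_subset[OF assms(1)]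
    by (intro countable_image) (blast intro: countable_subset)
qed

lemma infinite_uniqueness_set:
  assumes "infinite {d. univoque l d}" shows "infinite (uniqueness_set \<kappa>)"
  using assms inj_on_face_point face_point_in
  by (metis (mono_tags, lifting) finite_imageD finite_subset image_subsetI mem_Collect_eq)

lemma uncountable_uniqueness_set:
  assumes "uncountable {d. univoque l d}" shows "uncountable (uniqueness_set \<kappa>)"
  using assms inj_on_face_point face_point_in
  by (metis (mono_tags, lifting) countable_image_inj_on countable_subset image_subsetI mem_Collect_eq)

end

text \<open>The argument of \<open>\<kappa> ^ j\<close> is a multiple of \<open>pi\<close> if and only if \<open>q\<close> divides \<open>2 * j\<close>, by coprimality;
this is where the definition of \<open>q'\<close> comes from. If \<open>q\<close> is even, then \<open>p\<close> is odd and
\<open>\<kappa> ^ q'\<close> is negative.\<close>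

lemma rational_rotation_polar:
  fixes \<kappa> :: complex and \<rho> :: real and p :: int and q q' :: nat
  assumes k: "\<kappa> = of_real \<rho> * exp (2 * of_real pi * \<i> * of_int p / of_nat q)"
    and rho: "0 < \<rho>" "\<rho> < 1"
    and cop: "coprime p (int q)" and q: "q \<ge> 1"
    and q': "q' = (if odd q then q else q div 2)"
  shows "rational_rotation \<kappa> q' (\<rho> ^ q') (if odd q then 1 else -1)"
proof
  have q'pos: "0 < q'" using q q' by (auto elim!: evenE)
  have kj: "\<kappa> ^ j = of_real (\<rho> ^ j) * cis (2 * pi * of_int p * of_nat j / of_nat q)" for j
  proof -
    have "exp (2 * of_real pi * \<i> * of_int p / of_nat q) = cis (2 * pi * of_int p / of_nat q)"
      by (simp add: cis_conv_exp mult_ac)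
    then have "\<kappa> ^ j = of_real (\<rho> ^ j) * cis (of_nat j * (2 * pi * of_int p / of_nat q))"
      by (simp only: k power_mult_distrib Complex.DeMoivre of_real_power)
    also have "of_nat j * (2 * pi * of_int p / of_nat q) = 2 * pi * of_int p * of_nat j / of_nat q"
      by simp
    finally show ?thesis .
  qed
  show "0 < \<rho> ^ q'" "\<rho> ^ q' < 1" "0 < q'" using rho q'pos by (auto simp: power_less_one_iff)
  show "(if odd q then 1 else -1) = - 1 \<or> (if odd q then 1 else -1) = (1::int)" by simp
  show "\<kappa> ^ q' = of_real (of_int (if odd q then 1 else -1) * \<rho> ^ q')"
  proof (cases "odd q")
    case True
    then have "2 * pi * of_int p * of_nat q' / of_nat q = 2 * pi * of_int p" using q by (simp add: q')
    then show ?thesis using True by (simp add: kj cis_multiple_2pi)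
  next
    case False
    then obtain h where h: "q = 2 * h" "h > 0" using q by (auto elim!: evenE)
    then have "odd p" using cop by (auto simp: coprime_iff_gcd_eq_1[symmetric] coprime_commute dest: coprime_common_divisor[of _ _ 2])
    moreover have "2 * pi * of_int p * of_nat q' / of_nat q = of_int p * pi" using h by (simp add: q')
    moreover have "cis (of_int p * pi) = -1" if "odd p" for p :: int
    proof -
      from that obtain i where "p = 2 * i + 1" by (auto elim: oddE)
      then have "of_int p * pi = 2 * pi * of_int i + pi" by (simp add: algebra_simps)
      then show ?thesis by (simp add: cis_mult[symmetric] cis_multiple_2pi)
    qed
    ultimately show ?thesis using False by (simp add: kj)
  qed
  fix j assume nd: "\<not> q' dvd j"
  show "Im (\<kappa> ^ j) \<noteq> 0"
  proof
    assume "Im (\<kappa> ^ j) = 0"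
    then have "sin (2 * pi * of_int p * of_nat j / of_nat q) = 0" using rho by (simp add: kj)
    then obtain i where "2 * pi * of_int p * of_nat j / of_nat q = of_int i * pi"
      unfolding sin_zero_iff_int2 by blast
    then have "real_of_int (2 * p * int j) = of_int (i * int q)" using q by (simp add: field_simps)
    then have "p * (2 * int j) = i * int q" by (simp only: of_int_eq_iff mult_ac)
    then have "int q dvd p * (2 * int j)" by simp
    then have "int q dvd int (2 * j)" using cop by (simp add: coprime_dvd_mult_right_iff coprime_commute)
    then have "q dvd 2 * j" by (simp only: int_dvd_int_iff)
    then have "q' dvd j"
    proof (cases "odd q")
      case True
      then show ?thesis using \<open>q dvd 2 * j\<close> by (simp add: q' coprime_dvd_mult_right_iff)
    next
      case False
      then show ?thesis using \<open>q dvd 2 * j\<close> by (auto simp: q' elim!: evenE)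
    qed
    then show False using nd by simp
  qed
qed


section \<open>Hausdorff measure and dimension\<close>

text \<open>Null sets in terms of covers, without the infimum and supremum of the measure.\<close>

definition hausdorff_null :: "real \<Rightarrow> complex set \<Rightarrow> bool" where
  "hausdorff_null s E \<longleftrightarrow> (\<forall>\<epsilon>>0. \<forall>\<delta>>0. \<exists>U :: nat \<Rightarrow> complex set. E \<subseteq> (\<Union>i. U i) \<and>
     (\<forall>i. bounded (U i) \<and> diameter (U i) \<le> \<delta>) \<and>
     (\<Sum>i. ennreal (diameter (U i) powr s)) \<le> ennreal \<epsilon>)"

lemma hausdorff_null_measure: "hausdorff_null s E \<Longrightarrow> hausdorff_measure s E = 0"
proof -
  assume N: "hausdorff_null s E"
  have "hausdorff_premeasure s \<delta> E \<le> ennreal \<epsilon>" if pos: "\<delta> > 0" "\<epsilon> > 0" for \<delta> \<epsilon>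
  proof -
    obtain U :: "nat \<Rightarrow> complex set" where U: "E \<subseteq> (\<Union>i. U i)" "\<forall>i. bounded (U i) \<and> diameter (U i) \<le> \<delta>"
      "(\<Sum>i. ennreal (diameter (U i) powr s)) \<le> ennreal \<epsilon>"
      using N pos unfolding hausdorff_null_def by metis
    show ?thesis unfolding hausdorff_premeasure_def
      using U by (intro INF_lower2[of U]) auto
  qed
  then have "hausdorff_premeasure s \<delta> E = 0" if "\<delta> > 0" for \<delta>
    using that by (metis ennreal_le_epsilon add_0 le_zero_eq)
  then show ?thesis unfolding hausdorff_measure_def by (simp add: SUP_eq_const)
qed

text \<open>Cover the \<open>n\<close>-th set with total weight \<open>\<epsilon> / 2 ^ (n + 1)\<close> and merge the covers along a pairing
function.\<close>

lemma hausdorff_null_UN: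
  fixes E :: "nat \<Rightarrow> complex set"
  assumes "\<And>n. hausdorff_null s (E n)" shows "hausdorff_null s (\<Union>n. E n)"
  unfolding hausdorff_null_def
proof (intro allI impI)
  fix \<epsilon> \<delta> :: real assume "\<epsilon> > 0" "\<delta> > 0"
  then have pos: "0 < \<epsilon> * (1 / 2) ^ Suc n" for n by simp
  have "\<forall>n. \<exists>U :: nat \<Rightarrow> complex set. E n \<subseteq> (\<Union>i. U i) \<and>
     (\<forall>i. bounded (U i) \<and> diameter (U i) \<le> \<delta>) \<and>
     (\<Sum>i. ennreal (diameter (U i) powr s)) \<le> ennreal (\<epsilon> * (1 / 2) ^ Suc n)"
    using assms pos \<open>\<delta> > 0\<close> unfolding hausdorff_null_def by blast
  then obtain U :: "nat \<Rightarrow> nat \<Rightarrow> complex set" where U: "\<And>n. E n \<subseteq> (\<Union>i. U n i)"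
     "\<And>n i. bounded (U n i) \<and> diameter (U n i) \<le> \<delta>"
     "\<And>n. (\<Sum>i. ennreal (diameter (U n i) powr s)) \<le> ennreal (\<epsilon> * (1 / 2) ^ Suc n)"
    by metis
  define V where "V k = (case prod_decode k of (n, i) \<Rightarrow> U n i)" for k
  have "(\<Union>n. E n) \<subseteq> (\<Union>k. V k)"
  proof
    fix x assume "x \<in> (\<Union>n. E n)"
    then obtain n i where "x \<in> U n i" using U(1) by blast
    then have "x \<in> V (prod_encode (n, i))" by (simp add: V_def)
    then show "x \<in> (\<Union>k. V k)" by blast
  qed
  moreover have "bounded (V k) \<and> diameter (V k) \<le> \<delta>" for k
    using U(2) by (simp add: V_def split: prod.split)
  moreover have "(\<Sum>k. ennreal (diameter (V k) powr s)) \<le> ennreal \<epsilon>"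
  proof -
    have "(\<Sum>k. ennreal (diameter (V k) powr s)) =
        (\<Sum>k. (\<lambda>(n, i). ennreal (diameter (U n i) powr s)) (prod_decode k))"
      by (intro suminf_cong) (simp add: V_def split: prod.split)
    also have "\<dots> = (\<Sum>n. \<Sum>i. ennreal (diameter (U n i) powr s))"
      by (rule suminf_ennreal_2dimen) simp
    also have "\<dots> \<le> (\<Sum>n. ennreal (\<epsilon> * (1 / 2) ^ Suc n))"
      by (intro suminf_le U) auto
    also have "\<dots> = ennreal (\<epsilon> * 1)"
      using \<open>\<epsilon> > 0\<close> by (intro suminf_ennreal_eq sums_mult power_half_series) auto
    finally show ?thesis by simp
  qed
  ultimately show "\<exists>U :: nat \<Rightarrow> complex set. (\<Union>n. E n) \<subseteq> (\<Union>i. U i) \<and>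
     (\<forall>i. bounded (U i) \<and> diameter (U i) \<le> \<delta>) \<and>
     (\<Sum>i. ennreal (diameter (U i) powr s)) \<le> ennreal \<epsilon>" by blast
qed

lemma hausdorff_null_subset: "hausdorff_null s F \<Longrightarrow> E \<subseteq> F \<Longrightarrow> hausdorff_null s E"
  unfolding hausdorff_null_def by (meson order_trans)

lemma hausdorff_null_finite_covers:
  fixes E :: "complex set" and B :: nat
  assumes s: "0 < s" and r: "0 < r" "r < 1" and C: "0 < C" and small: "real B * r powr s < 1"
    and cov: "\<And>n. \<exists>\<C>. finite \<C> \<and> card \<C> \<le> B ^ n \<and> E \<subseteq> \<Union>\<C> \<and>
      (\<forall>X\<in>\<C>. \<forall>x\<in>X. \<forall>y\<in>X. dist x y \<le> r ^ n * C)"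
  shows "hausdorff_null s E"
  unfolding hausdorff_null_def
proof (intro allI impI)
  fix \<epsilon> \<delta> :: real assume pos: "\<epsilon> > 0" "\<delta> > 0"
  have "(\<lambda>n. (real B * r powr s) ^ n * C powr s) \<longlonglongrightarrow> 0"
    using small by (intro tendsto_mult_left_zero LIMSEQ_power_zero) auto
  then have ev1: "\<forall>\<^sub>F n in sequentially. (real B * r powr s) ^ n * C powr s < \<epsilon>"
    using pos by (intro order_tendstoD) auto
  have "(\<lambda>n. r ^ n * C) \<longlonglongrightarrow> 0"
    using r by (intro tendsto_mult_left_zero LIMSEQ_power_zero) auto
  then have ev2: "\<forall>\<^sub>F n in sequentially. r ^ n * C < \<delta>"
    using pos by (intro order_tendstoD) auto
  obtain n where n: "(real B * r powr s) ^ n * C powr s < \<epsilon>" "r ^ n * C < \<delta>"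
    using eventually_happens[OF eventually_conj[OF ev1 ev2]] by auto
  obtain \<C> where cc: "finite \<C>" "card \<C> \<le> B ^ n" "E \<subseteq> \<Union>\<C>"
      "\<And>X x y. X \<in> \<C> \<Longrightarrow> x \<in> X \<Longrightarrow> y \<in> X \<Longrightarrow> dist x y \<le> r ^ n * C"
    using cov[of n] by metis
  obtain f where f: "bij_betw f {..<card \<C>} \<C>"
    using ex_bij_betw_nat_finite[OF cc(1)] by (auto simp: atLeast0LessThan)
  define U where "U i = (if i < card \<C> then f i else {})" for i
  have rC: "0 \<le> r ^ n * C" using r C by simp
  have Ud: "dist x y \<le> r ^ n * C" if "x \<in> U i" "y \<in> U i" for i x y
    using that cc(4)[of "f i"] f by (auto simp: U_def bij_betw_def split: if_splits)
  have Ub: "bounded (U i)" for i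
  proof (cases "U i = {}")
    case False
    then obtain x where "x \<in> U i" by blast
    then have "U i \<subseteq> cball x (r ^ n * C)" using Ud by auto
    then show ?thesis using bounded_subset bounded_cball by blast
  qed simp
  have diam: "diameter (U i) \<le> r ^ n * C" for i
    using Ud rC by (intro diameter_le) (auto simp: dist_norm)
  have "(\<Sum>i. ennreal (diameter (U i) powr s)) = (\<Sum>i<card \<C>. ennreal (diameter (U i) powr s))"
    by (intro suminf_finite) (auto simp: U_def)
  also have "\<dots> \<le> (\<Sum>i<card \<C>. ennreal ((r ^ n * C) powr s))"
    using diam Ub s by (intro sum_mono ennreal_leI powr_mono2 diameter_ge_0) auto
  also have "\<dots> = ennreal (real (card \<C>) * (r ^ n * C) powr s)"
    by (simp add: ennreal_of_nat_eq_real_of_nat ennreal_mult)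
  also have "\<dots> \<le> ennreal (real (B ^ n) * (r ^ n * C) powr s)"
    using cc(2) by (intro ennreal_leI mult_right_mono) (simp only: of_nat_le_iff, simp)
  also have "real (B ^ n) * (r ^ n * C) powr s = (real B * r powr s) ^ n * C powr s"
    using r C by (simp add: powr_mult power_mult_distrib powr_realpow[symmetric] powr_powr mult.commute)
  also have "ennreal \<dots> \<le> ennreal \<epsilon>" using n by (intro ennreal_leI) simp
  finally have "(\<Sum>i. ennreal (diameter (U i) powr s)) \<le> ennreal \<epsilon>" .
  moreover have "E \<subseteq> (\<Union>i. U i)"
  proof
    fix x assume "x \<in> E"
    then obtain X where "X \<in> \<C>" "x \<in> X" using cc(3) by blast
    then obtain i where "i < card \<C>" "X = f i" using f by (auto simp: bij_betw_def)
    then have "x \<in> U i" using \<open>x \<in> X\<close> by (simp add: U_def)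
    then show "x \<in> (\<Union>i. U i)" by blast
  qed
  moreover have "diameter (U i) \<le> \<delta>" for i using diam[of i] n by simp
  ultimately show "\<exists>U :: nat \<Rightarrow> complex set. E \<subseteq> (\<Union>i. U i) \<and>
     (\<forall>i. bounded (U i) \<and> diameter (U i) \<le> \<delta>) \<and>
     (\<Sum>i. ennreal (diameter (U i) powr s)) \<le> ennreal \<epsilon>" using Ub by blast
qed

lemma hausdorff_dim_zero:
  assumes "\<And>s. 0 < s \<Longrightarrow> hausdorff_measure s E = 0" shows "hausdorff_dim E = 0"
proof (rule antisym)
  show "0 \<le> hausdorff_dim E" unfolding hausdorff_dim_def by (intro INF_greatest) auto
  show "hausdorff_dim E \<le> 0"
  proof (rule ccontr)
    assume "\<not> hausdorff_dim E \<le> 0"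
    then have "0 < hausdorff_dim E" by simp
    then obtain x where x: "0 < ereal x" "ereal x < hausdorff_dim E"
      using ereal_dense2[of 0 "hausdorff_dim E"] by blast
    then have "hausdorff_dim E \<le> ereal x"
      unfolding hausdorff_dim_def using assms by (intro INF_lower) auto
    then show False using x by simp
  qed
qed

lemma hausdorff_dim_ge:
  assumes "\<And>s. 0 < s \<Longrightarrow> s \<le> t \<Longrightarrow> hausdorff_measure s E \<noteq> 0" shows "ereal t \<le> hausdorff_dim E"
  unfolding hausdorff_dim_def using assms by (intro INF_greatest) force

text \<open>A cover of \<open>E\<close> by sets of diameter \<open>\<Delta>\<close> is turned by the Hoelder map \<open>g e \<mapsto> b e\<close> into a cover of the
unit interval by intervals of length \<open>2 * D * \<Delta> powr s\<close>, whose sum is at least 1. Since the diameters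
are at most 1, the Hoelder exponent \<open>t\<close> may be lowered to \<open>s\<close>.\<close>

lemma hoelder_parametrization_measure_pos:
  fixes g :: "'i \<Rightarrow> 'a :: metric_space" and b :: "'i \<Rightarrow> real"
  assumes g: "range g \<subseteq> E" and b: "{0..1} \<subseteq> range b" and D: "0 < D"
    and H: "\<And>e e'. \<bar>b e - b e'\<bar> \<le> D * dist (g e) (g e') powr t"
    and s: "0 < s" "s \<le> t"
  shows "hausdorff_measure s E \<noteq> 0"
proof
  assume "hausdorff_measure s E = 0"
  moreover have "hausdorff_premeasure s 1 E \<le> hausdorff_measure s E"
    unfolding hausdorff_measure_def by (intro SUP_upper) auto
  ultimately have "hausdorff_premeasure s 1 E < ennreal (1 / (4 * D))" using D by simp
  then obtain U :: "nat \<Rightarrow> 'a set" where U: "E \<subseteq> (\<Union>i. U i)" "\<And>i. bounded (U i)" "\<And>i. diameter (U i) \<le> 1"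
    and small: "(\<Sum>i. ennreal (diameter (U i) powr s)) < ennreal (1 / (4 * D))"
    unfolding hausdorff_premeasure_def INF_less_iff by blast
  define h where "h i = D * diameter (U i) powr s" for i
  have h0: "0 \<le> h i" for i using D by (simp add: h_def)
  define J where "J i = (if \<exists>e. g e \<in> U i then {b (SOME e. g e \<in> U i) - h i .. b (SOME e. g e \<in> U i) + h i} else {})" for i
  have "{0..1} \<subseteq> (\<Union>i. J i)"
  proof
    fix x :: real assume "x \<in> {0..1}"
    then obtain e where e: "x = b e" using b by blast
    obtain i where i: "g e \<in> U i" using U(1) g by blast
    let ?e = "SOME e. g e \<in> U i"
    have i': "g ?e \<in> U i" using i by (rule someI)
    have d: "dist (g e) (g ?e) \<le> diameter (U i)" by (rule diameter_bounded_bound[OF U(2) i i'])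
    have "\<bar>b e - b ?e\<bar> \<le> D * dist (g e) (g ?e) powr t" by (rule H)
    also have "\<dots> \<le> D * dist (g e) (g ?e) powr s"
      using D s d U(3)[of i] by (intro mult_left_mono powr_mono') auto
    also have "\<dots> \<le> h i"
      unfolding h_def using D s d by (intro mult_left_mono powr_mono2) auto
    finally have "x \<in> J i" using i by (auto simp: J_def e)
    then show "x \<in> (\<Union>i. J i)" by blast
  qed
  then have "emeasure lborel {0..1::real} \<le> emeasure lborel (\<Union>i. J i)"
    by (intro emeasure_mono) (auto simp: J_def)
  also have "\<dots> \<le> (\<Sum>i. emeasure lborel (J i))"
    by (intro emeasure_subadditive_countably) (auto simp: J_def)
  also have "\<dots> \<le> (\<Sum>i. ennreal (2 * D) * ennreal (diameter (U i) powr s))"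
  proof (intro suminf_le allI)
    fix i
    have "emeasure lborel (J i) \<le> ennreal (2 * h i)"
      using h0[of i] by (simp add: J_def)
    also have "\<dots> = ennreal (2 * D) * ennreal (diameter (U i) powr s)"
      using D by (simp add: h_def flip: ennreal_mult')
    finally show "emeasure lborel (J i) \<le> ennreal (2 * D) * ennreal (diameter (U i) powr s)" .
  qed auto
  also have "\<dots> = ennreal (2 * D) * (\<Sum>i. ennreal (diameter (U i) powr s))" by simp
  also have "\<dots> \<le> ennreal (2 * D) * ennreal (1 / (4 * D))"
    using small by (intro mult_left_mono) auto
  also have "\<dots> = ennreal (1 / 2)" using D by (simp flip: ennreal_mult')
  also have "emeasure lborel {0..1::real} = ennreal 1" by simp
  finally show False by (subst (asm) ennreal_le_iff) simp_all
qed

section \<open>The dimension of the set of uniqueness\<close>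

text \<open>A prefix \<open>w\<close> followed by blocks of length \<open>L\<close>, each of which is \<open>u\<close> or \<open>v\<close> as decided by \<open>c\<close>.
The triple \<open>(w, u, v)\<close> ranges over a countable type; only \<open>c\<close> has uncountably many values.\<close>

definition scheme :: "nat \<Rightarrow> bool list \<times> bool list \<times> bool list \<Rightarrow> (nat \<Rightarrow> bool) \<Rightarrow> nat \<Rightarrow> bool" where
  "scheme L P c j = (case P of (w, u, v) \<Rightarrow>
     if j < length w then w ! j
     else (if c ((j - length w) div L) then u else v) ! ((j - length w) mod L))"

lemma two_block_scheme:
  assumes "\<And>K. tm_bounded K d" shows "\<exists>P c. d = scheme (2 ^ k) P c"
proof -
  obtain m u c where B: "\<forall>i. \<forall>j<2 ^ k. d (m + i * 2 ^ k + j) = u (c i :: bool) j"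
    using two_block_structure[OF assms] by blast
  let ?P = "(map d [0..<m], map (u True) [0..<2 ^ k], map (u False) [0..<2 ^ k])"
  have "d j = scheme (2 ^ k) ?P c j" for j
  proof (cases "j < m")
    case False
    let ?i = "(j - m) div 2 ^ k" and ?r = "(j - m) mod 2 ^ k"
    have "j = m + ?i * 2 ^ k + ?r" using False div_mult_mod_eq[of "j - m" "2 ^ k"] by linarith
    then have "d j = u (c ?i) ?r" using B[rule_format, of ?r ?i] by simp
    then show ?thesis using False by (simp add: scheme_def)
  qed (simp add: scheme_def)
  then show ?thesis by blast
qed

lemma scheme_cong:
  assumes "\<And>i. i < n \<Longrightarrow> c i = c' i" "j < n * L" shows "scheme L P c j = scheme L P c' j"
proof -
  obtain w u v where P: "P = (w, u, v)" by (cases P)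
  have "0 < L" using assms(2) by (cases L) auto
  then have "(j - length w) div L < n"
    using assms(2) by (simp add: div_less_iff_less_mult less_imp_diff_less)
  then show ?thesis using assms(1) by (simp add: scheme_def P)
qed

lemma lex_less_at_theta_iter:
  "lex_less_at i e e' \<Longrightarrow> lex_less_at (i * 2 ^ k) ((theta ^^ k) e) ((theta ^^ k) e')"
proof (induction k)
  case (Suc k)
  then show ?case by (auto simp: lex_less_at_theta)
qed simp

context rational_rotation
begin

text \<open>For each residue the digits follow a scheme with blocks of length \<open>L = 2 ^ k\<close>. For a fixed choice
of schemes, \<open>2 ^ (m * n)\<close> sets of diameter of order \<open>l ^ (L * n)\<close> cover the corresponding points,
because \<open>norm \<kappa> ^ m = l\<close>. For large \<open>k\<close> the \<open>s\<close>-dimensional weight of these covers tends to 0, and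
there are only countably many choices of schemes.\<close>

lemma uniqueness_set_null:
  assumes "1 / 2 \<le> l" "1 \<le> val l tau" "0 < s"
  shows "hausdorff_null s (uniqueness_set \<kappa>)"
proof -
  obtain k where k: "real (2 ^ m) * (l ^ 2 ^ k) powr s < 1"
  proof -
    have "(\<lambda>n. real (2 ^ m) * (l powr s) ^ n) \<longlonglongrightarrow> 0"
      using l powr_less_mono2[OF assms(3), of l 1] by (intro tendsto_mult_right_zero LIMSEQ_power_zero) simp
    from order_tendstoD(2)[OF this, of 1] obtain N where N: "\<And>n. n \<ge> N \<Longrightarrow> real (2 ^ m) * (l powr s) ^ n < 1"
      unfolding eventually_sequentially by auto
    have "real (2 ^ m) * (l powr s) ^ (2 ^ N) < 1" using less_exp[of N] by (intro N) simp
    then show ?thesis using l by (intro that[of N]) (simp add: powr_realpow[symmetric] powr_powr mult.commute)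
  qed
  define L where "L = (2 ^ k :: nat)"
  define E where "E P = address_point \<kappa> ` {a \<in> sign_seqs. \<forall>r<m. \<exists>c. residue_digits r a = scheme L (P ! r) c}" for P
  have cover: "hausdorff_null s (E P)" for P
  proof (rule hausdorff_null_finite_covers[of s "l ^ L" "2 / (1 - norm \<kappa>)" "2 ^ m"])
    show "0 < s" "0 < l ^ L" "l ^ L < 1" "0 < 2 / (1 - norm \<kappa>)" "real (2 ^ m) * (l ^ L) powr s < 1"
      using assms l norm_kappa k by (auto simp: L_def power_less_one_iff)
    fix n :: nat
    let ?I = "{..<m} \<times> {..<n}"
    define X where "X C = address_point \<kappa> ` {a \<in> sign_seqs. \<forall>r<m. \<exists>c. residue_digits r a = scheme L (P ! r) c \<and> (\<forall>i<n. c i = C (r, i))}" for C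
    let ?C = "X ` (?I \<rightarrow>\<^sub>E (UNIV :: bool set))"
    have "finite ?C" by (intro finite_imageI finite_PiE) auto
    moreover have "card ?C \<le> (2 ^ m) ^ n"
    proof -
      have "card ?C \<le> card (?I \<rightarrow>\<^sub>E (UNIV :: bool set))" by (intro card_image_le finite_PiE) auto
      also have "\<dots> = (2 ^ m) ^ n" by (simp add: card_funcsetE power_mult)
      finally show ?thesis .
    qed
    moreover have "E P \<subseteq> \<Union>?C"
    proof
      fix z assume "z \<in> E P"
      then obtain a where a: "a \<in> sign_seqs" "z = address_point \<kappa> a"
          "\<forall>r<m. \<exists>c. residue_digits r a = scheme L (P ! r) c"
        unfolding E_def by blast
      then obtain c where c: "\<And>r. r < m \<Longrightarrow> residue_digits r a = scheme L (P ! r) (c r)" by metis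
      let ?f = "restrict (\<lambda>(r, i). c r i) ?I"
      have "z \<in> X ?f" unfolding X_def using a c by (intro image_eqI[of _ _ a]) auto
      moreover have "?f \<in> ?I \<rightarrow>\<^sub>E UNIV" by auto
      ultimately show "z \<in> \<Union>?C" by blast
    qed
    moreover have "dist x y \<le> (l ^ L) ^ n * (2 / (1 - norm \<kappa>))" if Y: "Y \<in> ?C" and xy: "x \<in> Y" "y \<in> Y" for Y x y
    proof -
      obtain C where "Y = X C" using Y by blast
      with xy obtain a b where ab: "a \<in> sign_seqs" "b \<in> sign_seqs" "x = address_point \<kappa> a" "y = address_point \<kappa> b"
        and ca: "\<forall>r<m. \<exists>c. residue_digits r a = scheme L (P ! r) c \<and> (\<forall>i<n. c i = C (r, i))"
        and cb: "\<forall>r<m. \<exists>c. residue_digits r b = scheme L (P ! r) c \<and> (\<forall>i<n. c i = C (r, i))"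
        unfolding X_def by blast
      have rd: "residue_digits r a j = residue_digits r b j" if "r < m" "j < n * L" for r j
      proof -
        obtain c c' where "residue_digits r a = scheme L (P ! r) c" "\<forall>i<n. c i = C (r, i)"
          "residue_digits r b = scheme L (P ! r) c'" "\<forall>i<n. c' i = C (r, i)"
          using ca cb \<open>r < m\<close> by blast
        then show ?thesis using scheme_cong[of n c c' j L "P ! r"] that(2) by simp
      qed
      have agree: "a j = b j" if "j < m * (L * n)" for j
      proof -
        have "j mod m < m" "j div m < n * L"
          using that m by (auto simp: less_mult_imp_div_less mult_ac)
        then have "assemble (\<lambda>r. residue_digits r a) j = assemble (\<lambda>r. residue_digits r b) j"
          using rd by (simp add: assemble_def)
        then show ?thesis using ab by (simp add: assemble_residue_digits)
      qed
      have "dist x y \<le> norm \<kappa> ^ (m * (L * n)) * (2 / (1 - norm \<kappa>))"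
        unfolding ab(3,4) by (rule dist_address_point[OF norm_kappa ab(1,2)]) (rule agree)
      then show ?thesis by (simp add: power_mult norm_kappa_m)
    qed
    ultimately show "\<exists>\<C>. finite \<C> \<and> card \<C> \<le> (2 ^ m) ^ n \<and> E P \<subseteq> \<Union>\<C> \<and>
      (\<forall>X\<in>\<C>. \<forall>x\<in>X. \<forall>y\<in>X. dist x y \<le> (l ^ L) ^ n * (2 / (1 - norm \<kappa>)))"
      by (intro exI[of _ ?C] conjI ballI)
  qed
  have "uniqueness_set \<kappa> \<subseteq> (\<Union>n. E (from_nat n))"
  proof
    fix z assume "z \<in> uniqueness_set \<kappa>"
    then obtain a where a: "unique_address \<kappa> a" "z = address_point \<kappa> a"
      unfolding uniqueness_set_eq[OF norm_kappa] by blast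
    have "\<exists>P c. residue_digits r a = scheme L P c" if "r < m" for r
      unfolding L_def
    proof (rule two_block_scheme)
      fix K
      have "\<exists>k. lex_less_at k (after (residue_digits r a) n) tau" for n
        by (rule univoque_lex_less[OF l unique_address_residue_univoque[OF a(1) that assms(1)] assms(2)])
      then show "tm_bounded K (residue_digits r a)"
        unfolding tm_bounded_def using lex_less_at_asym by blast
    qed
    then obtain P c where P: "\<And>r. r < m \<Longrightarrow> residue_digits r a = scheme L (P r) (c r)" by metis
    then have "\<forall>r<m. \<exists>c. residue_digits r a = scheme L (map P [0..<m] ! r) c" by auto
    then have "z \<in> E (map P [0..<m])"
      unfolding E_def using a by (auto simp: unique_address_def)
    then have "z \<in> E (from_nat (to_nat (map P [0..<m])))" by simp
    then show "z \<in> (\<Union>n. E (from_nat n))" by blast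
  qed
  with hausdorff_null_UN[OF cover] show ?thesis by (rule hausdorff_null_subset)
qed

text \<open>For large \<open>k\<close> all \<open>k\<close>-fold substitutions \<open>G e\<close> are univoque. If \<open>e\<close> and \<open>e'\<close> first differ
at position \<open>i\<close>, their binary values differ by at most \<open>(1 / 2) ^ i\<close>, while the points of \<open>G e\<close> and
\<open>G e'\<close> have distance at least a constant times \<open>l ^ (i * L)\<close>, where \<open>L = 2 ^ k\<close>. So the binary value
is a Hoelder function of the point, with the exponent \<open>t\<close> that solves \<open>l ^ (L * t) = 1 / 2\<close>.\<close>

lemma hausdorff_dim_uniqueness_set_pos:
  assumes "val l tau < 1" shows "0 < hausdorff_dim (uniqueness_set \<kappa>)"
proof -
  obtain K where K: "\<And>d. tm_bounded K d \<Longrightarrow> univoque l d"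
    using tm_bounded_imp_univoque[OF l assms] by blast
  define k where "k = Suc K"
  define L where "L = (2 ^ k :: nat)"
  have KL: "K \<le> L" using less_exp[of k] by (simp add: k_def L_def)
  define G where "G e = (theta ^^ k) e" for e
  have uG: "univoque l (G e)" for e
    using tm_bounded_mono[OF tm_bounded_theta_iter KL[unfolded L_def]] by (auto simp: G_def intro: K)
  define c where "c = 2 / l * (l * l ^ Suc L)"
  have c: "0 < c" using l by (simp add: c_def)
  define t where "t = ln 2 / (real L * ln (1 / l))"
  have "0 < ln (1 / l)" using l by simp
  then have t: "0 < t" unfolding t_def by (simp add: L_def)
  have Rt: "(l ^ L) powr t = 1 / 2"
  proof -
    have "real L * ln l \<noteq> 0" using \<open>0 < ln (1 / l)\<close> l by (simp add: L_def ln_div)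
    then have "t * ln (l ^ L) = - ln 2" using l by (simp add: t_def ln_realpow ln_div)
    then show ?thesis using l by (simp add: powr_def exp_minus)
  qed
  have sep: "c * (l ^ L) ^ i \<le> dist (face_point (G e)) (face_point (G e'))" if ee: "lex_less_at i e e'" for i e e'
  proof -
    let ?p = "i * L"
    have L: "lex_less_at ?p (G e) (G e')"
      using lex_less_at_theta_iter[OF ee] by (simp add: G_def L_def)
    have "tail (Suc ?p) (G e) = after (G e) ?p" using L by (simp add: tail_Suc_eq lex_less_at_def)
    then have v: "val l (tail (Suc ?p) (G e)) < 1" using uG by (simp add: univoque_def)
    (* The next block begins with two different letters, one of which is a 1. This bounds the
       distance from below uniformly, although univoqueness only gives a strict inequality. *)
    have "\<exists>j\<le>L. tail (Suc ?p) (G e') j"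
    proof -
      have eq: "G e' = theta ((theta ^^ K) e')" by (simp add: G_def k_def)
      have "?p + L = 2 * ((i + 1) * 2 ^ K)" by (simp add: L_def k_def algebra_simps)
      then have "G e' (?p + L) \<or> G e' (Suc (?p + L))" unfolding eq by (simp add: theta_def)
      moreover have "Suc ?p + (L - 1) = ?p + L" "Suc ?p + L = Suc (?p + L)" by (simp_all add: L_def)
      ultimately have "tail (Suc ?p) (G e') (L - 1) \<or> tail (Suc ?p) (G e') L"
        by (simp only: tail_def)
      then show ?thesis by (meson diff_le_self order_refl)
    qed
    then obtain j where j: "j \<le> L" "tail (Suc ?p) (G e') j" by blast
    have "l ^ Suc L \<le> l ^ Suc j" using j l by (intro power_decreasing) auto
    also have "\<dots> \<le> val l (tail (Suc ?p) (G e'))" by (rule val_ge_power[OF l]) (rule j)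
    finally have "l ^ Suc ?p * l ^ Suc L \<le> val l (G e') - val l (G e)"
      unfolding val_diff[OF l L] using v l by (intro mult_left_mono) auto
    then have "2 / l * (l ^ Suc ?p * l ^ Suc L) \<le> dist (face_point (G e)) (face_point (G e'))"
      unfolding dist_face_point using l by (intro mult_left_mono) auto
    moreover have "l ^ Suc ?p = l * (l ^ L) ^ i" by (simp add: mult.commute[of i L] power_mult)
    ultimately show ?thesis unfolding c_def by (simp only: mult_ac)
  qed
  have half: "0 < (1 / 2 :: real)" "(1 / 2 :: real) < 1" by auto
  have hoelder1: "\<bar>val (1 / 2) e - val (1 / 2) e'\<bar> \<le> c powr (-t) * dist (face_point (G e)) (face_point (G e')) powr t"
    if ee: "lex_less_at i e e'" for i e e'
  proof -
    have "\<bar>val (1 / 2) e - val (1 / 2) e'\<bar> = \<bar>val (1 / 2) e' - val (1 / 2) e\<bar>"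
      by (rule abs_minus_commute)
    also have "\<dots> = (1 / 2) ^ Suc i * \<bar>1 + val (1 / 2) (tail (Suc i) e') - val (1 / 2) (tail (Suc i) e)\<bar>"
      by (simp only: val_diff[OF half ee] abs_mult power_abs abs_divide abs_one abs_numeral)
    also have "\<dots> \<le> (1 / 2) ^ Suc i * 2"
      using val_le[OF half, of "tail (Suc i) e'"] val_le[OF half, of "tail (Suc i) e"]
        val_nonneg[OF half, of "tail (Suc i) e'"] val_nonneg[OF half, of "tail (Suc i) e"]
      by (intro mult_left_mono) auto
    also have "\<dots> = ((l ^ L) powr t) ^ i" unfolding Rt by simp
    also have "\<dots> = ((l ^ L) ^ i) powr t"
      using l by (induction i) (simp_all add: powr_mult)
    also have "\<dots> = c powr (-t) * (c * (l ^ L) ^ i) powr t"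
    proof -
      have "c powr (-t) * c powr t = 1" using c by (simp flip: powr_add)
      then show ?thesis by (simp only: powr_mult mult.assoc[symmetric] mult_1_left)
    qed
    also have "\<dots> \<le> c powr (-t) * dist (face_point (G e)) (face_point (G e')) powr t"
      using sep[OF ee] c l t by (intro mult_left_mono powr_mono2) auto
    finally show ?thesis .
  qed
  have hoelder: "\<bar>val (1 / 2) e - val (1 / 2) e'\<bar> \<le> c powr (-t) * dist (face_point (G e)) (face_point (G e')) powr t" for e e'
  proof -
    consider "e = e'" | i where "lex_less_at i e e'" | i where "lex_less_at i e' e"
      using lex_trichotomy by metis
    then show ?thesis
    proof cases
      case 3
      from hoelder1[OF this] show ?thesis by (simp add: dist_commute abs_minus_commute)
    qed (use hoelder1 in auto)
  qed
  have "ereal t \<le> hausdorff_dim (uniqueness_set \<kappa>)"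
  proof (rule hausdorff_dim_ge)
    fix s assume s: "0 < s" "s \<le> t"
    show "hausdorff_measure s (uniqueness_set \<kappa>) \<noteq> 0"
    proof (rule hoelder_parametrization_measure_pos[where g = "\<lambda>e. face_point (G e)" and
        b = "val (1 / 2)" and D = "c powr (-t)" and t = t])
      show "range (\<lambda>e. face_point (G e)) \<subseteq> uniqueness_set \<kappa>" using face_point_in uG by auto
      show "{0..1} \<subseteq> range (val (1 / 2))"
      proof
        fix x :: real assume "x \<in> {0..1}"
        then obtain e where "val (1 / 2) e = x" using expansion_exists[OF half, of x] by auto
        then show "x \<in> range (val (1 / 2))" by blast
      qed
      show "0 < c powr (-t)" using c by simp
    qed (fact hoelder s)+
  qed
  then show ?thesis using t by (metis ereal_less(2) less_le_trans)
qed

end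

theorem theorem4p16:
  fixes \<kappa> :: complex and \<rho> \<beta> :: real and p :: int and q q' :: nat
  assumes "\<kappa> = of_real \<rho> * exp (2 * of_real pi * \<i> * of_int p / of_nat q)"
    and "\<kappa> \<notin> \<real>"
    and "0 < \<rho>" and "\<rho> < 1"
    and "coprime p (int q)" and "q \<ge> 1"
    and "q' = (if odd q then q else q div 2)"
    and "\<beta> = \<rho> powi (- int q')"
  shows "(\<beta> \<in> {1<..golden_ratio} \<longrightarrow>
            finite (uniqueness_set \<kappa>) \<and> uniqueness_set \<kappa> \<noteq> {}) \<and>
         (\<beta> \<in> {golden_ratio<..<komornik_loreti} \<longrightarrow>
            infinite (uniqueness_set \<kappa>) \<and> countable (uniqueness_set \<kappa>)) \<and>
         (\<beta> = komornik_loreti \<longrightarrow>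
            uncountable (uniqueness_set \<kappa>) \<and> hausdorff_dim (uniqueness_set \<kappa>) = 0) \<and>
         (\<beta> \<in> {komornik_loreti<..} \<longrightarrow>
            hausdorff_dim (uniqueness_set \<kappa>) > 0)"
proof -
  define l where "l = \<rho> ^ q'"
  interpret rational_rotation \<kappa> q' l "if odd q then 1 else -1"
    unfolding l_def by (rule rational_rotation_polar) fact+
  have beta: "\<beta> = 1 / l" "l = 1 / \<beta>" by (simp_all add: assms(8) l_def power_int_minus divide_inverse)
  have beta_pos: "0 < \<beta>" using l by (simp add: beta(1))
  let ?g = golden_ratio
  have g: "?g\<^sup>2 = ?g + 1" "1 < ?g" "?g \<le> 2"
  proof -
    have "sqrt 5 \<le> sqrt (3\<^sup>2)" by (subst real_sqrt_le_iff) simp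
    moreover have "1 < sqrt 5" by simp
    ultimately show "?g\<^sup>2 = ?g + 1" "1 < ?g" "?g \<le> 2"
      by (auto simp: golden_ratio_def power2_eq_square field_simps)
  qed
  have lsq: "l + l\<^sup>2 = (\<beta> + 1) / \<beta>\<^sup>2" using beta_pos by (simp add: beta(2) field_simps power2_eq_square)
  (* The golden ratio is the positive root of \<open>x\<^sup>2 - x - 1\<close>; \<open>1 - ?g\<close> is the other root. *)
  have factor: "\<beta>\<^sup>2 - \<beta> - 1 = (\<beta> - ?g) * (\<beta> + ?g - 1)"
    using g(1) by (simp add: algebra_simps power2_eq_square)
  have one: "finite (uniqueness_set \<kappa>) \<and> uniqueness_set \<kappa> \<noteq> {}" if "\<beta> \<in> {1<..?g}"
  proof
    have "\<beta>\<^sup>2 - \<beta> - 1 \<le> 0" unfolding factor using that g by (intro mult_nonpos_nonneg) auto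
    then have "1 \<le> l + l\<^sup>2" unfolding lsq using beta_pos by (simp add: field_simps)
    then have "{d. univoque l d} \<subseteq> range (\<lambda>b _. b)" using univoque_imp_const[OF l] by blast
    then have "finite {d. univoque l d}" by (rule finite_subset) simp
    moreover have "1 / 2 \<le> l" using that g beta_pos by (simp add: beta(2) field_simps)
    ultimately show "finite (uniqueness_set \<kappa>)" by (intro finite_uniqueness_set)
    show "uniqueness_set \<kappa> \<noteq> {}" using face_point_in[OF univoque_const[OF l]] by blast
  qed
  have kl: "0 < 1 / komornik_loreti" "1 / komornik_loreti < 1" "1 / 2 \<le> 1 / komornik_loreti"
    using komornik_loreti by (auto simp: field_simps)
  have two: "infinite (uniqueness_set \<kappa>) \<and> countable (uniqueness_set \<kappa>)" if "\<beta> \<in> {?g<..<komornik_loreti}"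
  proof
    have "0 < \<beta>\<^sup>2 - \<beta> - 1" unfolding factor using that g by (intro mult_pos_pos) auto
    then have "l + l\<^sup>2 < 1" unfolding lsq using beta_pos by (simp add: field_simps)
    then show "infinite (uniqueness_set \<kappa>)" by (intro infinite_uniqueness_set infinite_univoque[OF l])
    have lt: "1 / komornik_loreti < l" using that beta_pos by (auto simp: beta(2) intro!: divide_strict_left_mono)
    then have "1 < val l tau" using val_strict_mono_tau[OF kl(1) lt l(2)] komornik_loreti(3) by simp
    then obtain k where "\<And>d. univoque l d \<Longrightarrow> tm_strictly_bounded (2 ^ k) d"
      using univoque_strictly_bounded[OF l] by blast
    then have "{d. univoque l d} \<subseteq> {d. eventually_periodic d}"
      using strictly_bounded_eventually_periodic by blast
    then have "countable {d. univoque l d}"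
      using countable_eventually_periodic by (rule countable_subset)
    then show "countable (uniqueness_set \<kappa>)" by (rule countable_uniqueness_set[OF order_trans[OF kl(3) less_imp_le[OF lt]]])
  qed
  have three: "uncountable (uniqueness_set \<kappa>) \<and> hausdorff_dim (uniqueness_set \<kappa>) = 0" if "\<beta> = komornik_loreti"
  proof
    have v: "val l tau = 1" "1 / 2 \<le> l" using komornik_loreti kl that by (auto simp: beta(2))
    show "uncountable (uniqueness_set \<kappa>)"
      by (intro uncountable_uniqueness_set uncountable_univoque[OF l] v)
    show "hausdorff_dim (uniqueness_set \<kappa>) = 0"
      using v by (intro hausdorff_dim_zero hausdorff_null_measure uniqueness_set_null) auto
  qed
  have four: "0 < hausdorff_dim (uniqueness_set \<kappa>)" if "\<beta> \<in> {komornik_loreti<..}"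
  proof (rule hausdorff_dim_uniqueness_set_pos)
    have "l < 1 / komornik_loreti" using that komornik_loreti(1) by (auto simp: beta(2) intro!: divide_strict_left_mono mult_pos_pos)
    then show "val l tau < 1" using val_strict_mono_tau[OF l(1) _ kl(2)] komornik_loreti(3) by simp
  qed
  show ?thesis using one two three four by blast
qed

end
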